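(* Given a word $u$ of length $n$ and an integer $k$, it can be checked in $O(n)$ time whether $u$ has a seed of length $k$.
   Context: Words are over a finite alphabet. A word $s$ covers $w$ if every position of $w$ lies in some occurrence of $s$ as a factor of $w$. A seed of $u$ is a factor $s$ of $u$ such that $u$ is a factor of some word covered by $s$. *)

theory Defs
  imports Main
begin

definition factor :: "'a list \<Rightarrow> 'a list \<Rightarrow> bool" where
  "factor s w \<longleftrightarrow> (\<exists>x y. w = x @ s @ y)"

definition occurs_at :: "'a list \<Rightarrow> 'a list \<Rightarrow> nat \<Rightarrow> bool" where
  "occurs_at s w i \<longleftrightarrow> i + length s \<le> length w \<and> take (length s) (drop i w) = s"

definition covers :: "'a list \<Rightarrow> 'a list \<Rightarrow> bool" where
  "covers s w \<longleftrightarrow> (\<forall>p < length w. \<exists>i. occurs_at s w i \<and> i \<le> p \<and> p < i + length s)"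

definition seed :: "'a list \<Rightarrow> 'a list \<Rightarrow> bool" where
  "seed s u \<longleftrightarrow> factor s u \<and> (\<exists>v. covers s v \<and> factor u v)"

definition has_seed_of_length :: "'a list \<Rightarrow> nat \<Rightarrow> bool" where
  "has_seed_of_length u k \<longleftrightarrow> (\<exists>s. length s = k \<and> seed s u)"

text \<open>Memory is an unbounded array of w-bit words (cells indexed by naturals).
  Each instruction costs one time unit.  Arithmetic is modulo 2^w, subtraction is truncated.\<close>

datatype instr =
    LoadC nat nat
  | Add nat nat nat
  | Sub nat nat nat
  | Mul nat nat nat
  | Div nat nat nat
  | Load nat nat
  | Store nat nat
  | Jz nat nat
  | Jmp nat
  | Halt

type_synonym config = "nat \<times> (nat \<Rightarrow> nat)"

fun exec :: "nat \<Rightarrow> instr \<Rightarrow> config \<Rightarrow> config" where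
  "exec w (LoadC r c) (pc, m) = (Suc pc, m(r := c mod 2 ^ w))"
| "exec w (Add r a b) (pc, m) = (Suc pc, m(r := (m a + m b) mod 2 ^ w))"
| "exec w (Sub r a b) (pc, m) = (Suc pc, m(r := m a - m b))"
| "exec w (Mul r a b) (pc, m) = (Suc pc, m(r := (m a * m b) mod 2 ^ w))"
| "exec w (Div r a b) (pc, m) = (Suc pc, m(r := m a div m b))"
| "exec w (Load r a) (pc, m) = (Suc pc, m(r := m (m a)))"
| "exec w (Store a r) (pc, m) = (Suc pc, m(m a := m r))"
| "exec w (Jz r t) (pc, m) = (if m r = 0 then t else Suc pc, m)"
| "exec w (Jmp t) (pc, m) = (t, m)"
| "exec w Halt (pc, m) = (pc, m)"

definition halted :: "instr list \<Rightarrow> config \<Rightarrow> bool" where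
  "halted P cf \<longleftrightarrow> fst cf \<ge> length P \<or> P ! fst cf = Halt"

definition step :: "nat \<Rightarrow> instr list \<Rightarrow> config \<Rightarrow> config" where
  "step w P cf = (if halted P cf then cf else exec w (P ! fst cf) cf)"

text \<open>Input encoding: m[0] = n = |u|, m[1] = k, m[2+i] = u!i for i < n, all other cells 0.
  Execution starts at pc = 0.  The answer is read from m[0] after halting (1 = yes, 0 = no).\<close>

definition init_mem :: "nat list \<Rightarrow> nat \<Rightarrow> nat \<Rightarrow> nat" where
  "init_mem u k a = (if a = 0 then length u else if a = 1 then k
                     else if a < length u + 2 then u ! (a - 2) else 0)"

definition run :: "nat \<Rightarrow> instr list \<Rightarrow> nat \<Rightarrow> nat list \<Rightarrow> nat \<Rightarrow> config" where
  "run w P t u k = (step w P ^^ t) (0, init_mem u k)"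

end

theory Submission
  imports Defs
begin

text \<open>
  Let \<open>1 \<le> k \<le> n\<close>. A factor \<open>s\<close> of length \<open>k\<close> whose first occurrence in \<open>u\<close> is at \<open>p\<close> covers the
  letters before \<open>p\<close> by an overhanging occurrence iff \<open>u[0..p+k)\<close> has a period \<open>d\<close> with
  \<open>p < d \<le> k\<close>. This condition is downward closed in \<open>p\<close>, so it says \<open>p \<le> pm\<close>, and the symmetric
  condition bounds the last occurrence. With \<open>d\<close> the least period of \<open>u[0..pm+k)\<close>, only the candidates
  \<open>p \<le> min pm (d - 1)\<close> matter, and by Fine and Wilf these are pairwise distinct words; hence they have
  at most \<open>n\<close> occurrences altogether and all of them can be enumerated. For this, align position
  \<open>k\<close> of \<open>u\<close> with a position \<open>t\<close>: the candidates that occur there form an interval, whose ends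
  are longest common extensions delivered by the Z-algorithm. It remains to follow, for each candidate, the chain of
  occurrences with gaps at most \<open>k\<close> up to its end.

  On the machine, a program in a small language with scalars and unbounded arrays is compiled to instructions,
  and is verified with a weakest-precondition calculus that carries the elapsed time.
\<close>

section \<open>Seeds of a fixed length\<close>

text \<open>The period condition is downward closed because the \<open>d\<close> that serves
  \<open>p\<close> serves every smaller \<open>p\<close> as well. The cap \<open>d - 1\<close> comes
  from a shift: a candidate \<open>p >= d\<close> lies inside the prefix of length
  \<open>pm + k\<close>, which has period \<open>d\<close>, so the same word starts already at
  \<open>p - d\<close>. The obstacle is linear time: equal candidates would share their occurrences,
  and listing them could become quadratic. Distinctness lets each start position serve at most one
  candidate; it holds because a window of length \<open>k >= d\<close> shows a whole period.
  Position \<open>k\<close> is the point of alignment because \<open>p < d <= k\<close> gives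
  \<open>p < k <= p + k\<close>: the cut at \<open>k\<close> lies inside every candidate or at its
  right end, so a match splits into a forward and a backward extension from one fixed cut. On the
  machine, the obstacle is that a program names only finitely many cells, and nearly all of these
  may hold input. An exponent \<open>d\<close> that grows with \<sigma> makes a word wide enough to
  hold \<open>n\<close> and the first 39 letters together, which frees the cells.\<close>

definition eqf :: "'a list \<Rightarrow> nat \<Rightarrow> nat \<Rightarrow> nat \<Rightarrow> bool" where
  "eqf v i j l \<longleftrightarrow> i + l \<le> length v \<and> j + l \<le> length v \<and> (\<forall>x<l. v ! (i + x) = v ! (j + x))"

text \<open>The period \<open>d\<close> corresponds to an occurrence of \<open>u[p..p+k)\<close> that starts \<open>d - p\<close> letters before \<open>u\<close>
  and reaches at least to position \<open>p\<close>.\<close>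

definition extendable :: "'a list \<Rightarrow> nat \<Rightarrow> nat \<Rightarrow> bool" where
  "extendable u k p \<longleftrightarrow> (\<exists>d. p < d \<and> d \<le> k \<and> eqf u 0 d (p + k - d))"

section \<open>Covering and overhanging occurrences\<close>

lemma occurs_at_iff_nth:
  "occurs_at s w i \<longleftrightarrow> i + length s \<le> length w \<and> (\<forall>y<length s. w ! (i + y) = s ! y)"
  unfolding occurs_at_def by (auto simp: list_eq_iff_nth_eq)

lemma occurs_at_eqf:
  assumes "occurs_at s u p"
  shows "occurs_at s u q \<longleftrightarrow> eqf u p q (length s)"
  using assms unfolding occurs_at_iff_nth eqf_def by auto

lemma factor_iff_occurs_at: "factor s u \<longleftrightarrow> (\<exists>p. occurs_at s u p)"
proof
  assume "factor s u"
  then obtain x y where "u = x @ s @ y" unfolding factor_def by blast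
  then have "occurs_at s u (length x)" by (auto simp: occurs_at_def)
  then show "\<exists>p. occurs_at s u p" ..
next
  assume "\<exists>p. occurs_at s u p"
  then obtain p where p: "take (length s) (drop p u) = s" by (auto simp: occurs_at_def)
  have "u = take p u @ take (length s) (drop p u) @ drop (length s) (drop p u)"
    by (simp only: append_take_drop_id)
  then show "factor s u" unfolding factor_def p by blast
qed

lemma occurs_at_rev:
  assumes "occurs_at s w i"
  shows "occurs_at (rev s) (rev w) (length w - length s - i)"
proof -
  have i: "i + length s \<le> length w" "\<And>y. y < length s \<Longrightarrow> w ! (i + y) = s ! y"
    using assms by (auto simp: occurs_at_iff_nth)
  have "rev w ! (length w - length s - i + y) = rev s ! y" if y: "y < length s" for y
  proof -
    have "length w - Suc (length w - length s - i + y) = i + (length s - Suc y)"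
      using i(1) y by auto
    then show ?thesis using i(1) i(2)[of "length s - Suc y"] y by (simp add: rev_nth)
  qed
  then show ?thesis using i(1) unfolding occurs_at_iff_nth by auto
qed

lemma covers_rev:
  assumes "covers s w"
  shows "covers (rev s) (rev w)"
  unfolding covers_def
proof (intro allI impI)
  fix p assume p: "p < length (rev w)"
  then have "length w - 1 - p < length w" by auto
  then obtain i where i: "occurs_at s w i" "i \<le> length w - 1 - p" "length w - 1 - p < i + length s"
    using assms unfolding covers_def by blast
  from i(1) have "i + length s \<le> length w" by (simp add: occurs_at_def)
  with i p occurs_at_rev[OF i(1)]
  show "\<exists>i. occurs_at (rev s) (rev w) i \<and> i \<le> p \<and> p < i + length (rev s)"
    by (intro exI[of _ "length w - length s - i"]) auto
qed

text \<open>The occurrence that covers the letter just before \<open>p\<close> must start left of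
  \<open>u\<close>, since otherwise \<open>u\<close> would contain an occurrence before
  \<open>p\<close>. Its part inside \<open>u\<close> is a prefix of \<open>u\<close> and a suffix of
  \<open>s\<close>; matched with the end of the occurrence at \<open>p\<close>, this gives the
  period. For \<open>p = 0\<close> the period \<open>length s\<close> works, with nothing to
  compare.\<close>

lemma first_occurrence_extendable:
  assumes cov: "covers s (x @ u @ y)" and p: "occurs_at s u p"
    and first: "\<And>q. q < p \<Longrightarrow> \<not> occurs_at s u q" and s: "s \<noteq> []"
  shows "extendable u (length s) p"
proof (cases "p = 0")
  case True
  then show ?thesis
    using p s unfolding extendable_def eqf_def occurs_at_def
    by (intro exI[of _ "length s"]) auto
next
  case False
  let ?k = "length s"
  have pk: "p + ?k \<le> length u" using p by (simp add: occurs_at_def)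
  have "length x + p - 1 < length (x @ u @ y)" using pk False s by auto
  then obtain i where i: "occurs_at s (x @ u @ y) i" "i \<le> length x + p - 1" "length x + p - 1 < i + ?k"
    using cov unfolding covers_def by blast
  have ix: "i < length x"
  proof (rule ccontr)
    assume "\<not> i < length x"
    then have ix: "length x \<le> i" by simp
    have "u ! (i - length x + z) = s ! z" if z: "z < length s" for z
    proof -
      have "i + z = length x + (i - length x + z)" "i - length x + z < length u"
        using ix i(2) z pk False by auto
      then have "(x @ u @ y) ! (i + z) = u ! (i - length x + z)"
        by (simp only: nth_append_length_plus nth_append_left)
      then show ?thesis using i(1) z by (auto simp: occurs_at_iff_nth)
    qed
    then have "occurs_at s u (i - length x)"
      using ix i(2) pk False unfolding occurs_at_iff_nth by auto
    moreover have "i - length x < p" using i False by auto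
    ultimately show False using first by blast
  qed
  \<comment> \<open>The number of letters of this occurrence that lie in \<open>u\<close>. It is at
    least \<open>p\<close> because the letter before \<open>p\<close> is covered, and less than
    \<open>?k\<close> because the occurrence starts in \<open>x\<close>; hence the period
    \<open>p + ?k - l\<close> lies in the required range.\<close>
  define l where "l = i + ?k - length x"
  have ll: "l + length x = i + ?k" using i False unfolding l_def by auto
  have l: "p \<le> l" "l < ?k" using ix i False unfolding l_def by auto
  have "u ! z = u ! (p + ?k - l + z)" if z: "z < l" for z
  proof -
    have "?k - l + z < ?k" using z l by auto
    then have "s ! (?k - l + z) = (x @ u @ y) ! (i + (?k - l + z))"
      using i(1) unfolding occurs_at_iff_nth by metis
    also have "i + (?k - l + z) = length x + z" using l ll by auto
    also have "(x @ u @ y) ! (length x + z) = u ! z" using z l pk by (auto simp: nth_append)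
    finally have 1: "s ! (?k - l + z) = u ! z" .
    have "u ! (p + (?k - l + z)) = s ! (?k - l + z)"
      using p \<open>?k - l + z < ?k\<close> unfolding occurs_at_iff_nth by metis
    with 1 l show ?thesis by (simp add: add.assoc)
  qed
  then have "eqf u 0 (p + ?k - l) (p + ?k - (p + ?k - l))"
    using l pk unfolding eqf_def by auto
  then show ?thesis unfolding extendable_def
    by (intro exI[of _ "p + ?k - l"]) (use l in auto)
qed

text \<open>A covered word is built by adding to \<open>u\<close> only the letters by which one
  occurrence hangs over on either side. Since \<open>p\<close> and \<open>q\<close> are arbitrary
  occurrences, the algorithm never has to recognise the first or the last one.\<close>

lemma seedI:
  fixes u s :: "'a list"
  defines "k \<equiv> length s" and "n \<equiv> length u"
  assumes p: "occurs_at s u p" "extendable u k p"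
    and q: "occurs_at s u q" "extendable (rev u) k (n - k - q)"
    and mid: "\<And>c. p \<le> c \<Longrightarrow> c < q + k \<Longrightarrow> \<exists>a. occurs_at s u a \<and> a \<le> c \<and> c < a + k"
  shows "seed s u"
proof -
  obtain d where d: "p < d" "d \<le> k" and deq: "eqf u 0 d (p + k - d)"
    using p(2) unfolding extendable_def by blast
  define r where "r = n - k - q"
  obtain e where e: "r < e" "e \<le> k" and eeq: "eqf (rev u) 0 e (r + k - e)"
    using q(2) unfolding extendable_def r_def by blast
  have pk: "p + k \<le> n" and qk: "q + k \<le> n"
    using p q by (auto simp: occurs_at_def k_def n_def)
  have n: "n = q + k + r" using qk r_def by auto
  \<comment> \<open>One occurrence of \<open>s\<close> starts with \<open>x\<close> and continues
    into \<open>u\<close>, where it agrees with \<open>s\<close> by the period \<open>d\<close>;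
    another one ends with \<open>z\<close>, by the period \<open>e\<close> of the reversed
    word.\<close>
  define x where "x = take (d - p) s"
  define z where "z = drop (k - (e - r)) s"
  define v where "v = x @ u @ z"
  have lx: "length x = d - p" using d by (auto simp: x_def k_def)
  have lz: "length z = e - r" using e by (auto simp: z_def k_def)
  have lv: "length v = (d - p) + n + (e - r)" by (simp add: v_def lx lz n_def)
  have vu: "v ! (d - p + i) = u ! i" if "i < n" for i
    using that by (simp add: v_def nth_append lx n_def)
  have pers: "u ! i = u ! (i + d)" if "i + d < p + k" for i
    using deq that unfolding eqf_def by (auto simp: add.commute)
  have qers: "u ! i = u ! (i + e)" if i: "q \<le> i" "i + e < n" for i
  proof -
    have "n - 1 - e - i < r + k - e" using i n by auto
    then have "rev u ! (n - 1 - e - i) = rev u ! (e + (n - 1 - e - i))"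
      using eeq unfolding eqf_def by auto
    then have "u ! (n - Suc (n - 1 - e - i)) = u ! (n - Suc (e + (n - 1 - e - i)))"
      using i by (subst (asm) (1 2) rev_nth) (auto simp: n_def)
    moreover have "n - Suc (n - 1 - e - i) = i + e" "n - Suc (e + (n - 1 - e - i)) = i"
      using i by auto
    ultimately show ?thesis by simp
  qed
  have sp: "s ! y = u ! (p + y)" if "y < k" for y
    using p(1) that by (auto simp: occurs_at_iff_nth k_def)
  have sq: "s ! y = u ! (q + y)" if "y < k" for y
    using q(1) that by (auto simp: occurs_at_iff_nth k_def)
  have inner: "occurs_at s v (d - p + a)" if a: "occurs_at s u a" for a
    using a unfolding occurs_at_iff_nth lv
    by (auto simp: n_def add.assoc) (metis vu n_def add.assoc add_less_le_mono add.commute less_le_trans nat_add_left_cancel_less)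
  have left: "occurs_at s v 0"
  proof -
    have "v ! y = s ! y" if y: "y < k" for y
    proof (cases "y < d - p")
      case True
      then show ?thesis using y by (auto simp: v_def nth_append x_def k_def)
    next
      case False
      have "v ! (d - p + (y - (d - p))) = u ! (y - (d - p))" using y pk by (intro vu) auto
      also have "\<dots> = u ! (y - (d - p) + d)" using False y d by (intro pers) auto
      also have "y - (d - p) + d = p + y" using False d by auto
      finally show ?thesis using sp[OF y] False by simp
    qed
    then show ?thesis using pk lv unfolding occurs_at_iff_nth by (auto simp: k_def)
  qed
  have right: "occurs_at s v (d - p + q + e)"
  proof -
    have "v ! (d - p + q + e + y) = s ! y" if y: "y < k" for y
    proof (cases "q + e + y < n")
      case True
      have "v ! (d - p + (q + e + y)) = u ! (q + e + y)" using True by (rule vu)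
      also have "\<dots> = u ! (q + y)" using qers[of "q + y"] True by (auto simp: ac_simps)
      finally show ?thesis using sq[OF y] by (simp add: add.assoc)
    next
      case False
      have "v ! (d - p + q + e + y) = z ! (q + e + y - n)"
        using False by (auto simp: v_def nth_append lx n_def add.assoc)
      also have "\<dots> = s ! (k - (e - r) + (q + e + y - n))"
        using y e n by (auto simp: z_def k_def)
      also have "k - (e - r) + (q + e + y - n) = y" using False e n by auto
      finally show ?thesis .
    qed
    then show ?thesis using n e lv unfolding occurs_at_iff_nth by (auto simp: k_def)
  qed
  have "covers s v"
    unfolding covers_def
  proof (intro allI impI)
    fix c assume c: "c < length v"
    \<comment> \<open>Position \<open>p\<close> of \<open>u\<close> is position \<open>d\<close> of
      \<open>v\<close>, and \<open>d <= k\<close>, so the left occurrence leaves no hole before it.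
      Likewise the right occurrence starts at \<open>d - p + q + e\<close>, which is at most
      \<open>d - p + q + k\<close>.\<close>
    consider "c < k" | "d - p + p \<le> c" "c < d - p + q + k" | "d - p + q + k \<le> c" 
      using d by linarith
    then show "\<exists>i. occurs_at s v i \<and> i \<le> c \<and> c < i + length s"
    proof cases
      case 1
      with left show ?thesis by (auto simp: k_def intro!: exI[of _ 0])
    next
      case 2
      then have "p \<le> c - (d - p)" "c - (d - p) < q + k" by linarith+
      from mid[OF this] obtain a where a: "occurs_at s u a" "a \<le> c - (d - p)" "c - (d - p) < a + k"
        by blast
      with inner[OF a(1)] 2 show ?thesis
        by (intro exI[of _ "d - p + a"]) (auto simp: k_def)
    next
      case 3
      with right c e n lv show ?thesis
        by (intro exI[of _ "d - p + q + e"]) (auto simp: k_def)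
    qed
  qed
  moreover have "factor s u" using p factor_iff_occurs_at by blast
  ultimately show ?thesis unfolding seed_def v_def factor_def by blast
qed


text \<open>\<open>p\<close> and \<open>q\<close> are the first and the last occurrence in
  \<open>u\<close>. The condition at \<open>q\<close> is the one at \<open>p\<close> for the
  reversed words, where the last occurrence becomes the first.\<close>

lemma seedD:
  fixes u s :: "'a list"
  defines "k \<equiv> length s" and "n \<equiv> length u"
  assumes "seed s u" and s: "s \<noteq> []"
  obtains p q where "occurs_at s u p" "occurs_at s u q" "p \<le> q"
    "\<And>p'. occurs_at s u p' \<Longrightarrow> p \<le> p' \<and> p' \<le> q"
    "extendable u k p" "extendable (rev u) k (n - k - q)"
    "\<And>c. p \<le> c \<Longrightarrow> c \<le> q \<Longrightarrow> \<exists>a. occurs_at s u a \<and> a \<le> c \<and> c < a + k"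
proof -
  obtain x y where cov: "covers s (x @ u @ y)" and "factor s u"
    using assms(3) unfolding seed_def factor_def by blast
  define Q where "Q = {p. occurs_at s u p}"
  have "Q \<noteq> {}" using \<open>factor s u\<close> by (simp add: factor_iff_occurs_at Q_def)
  have "Q \<subseteq> {..n}" by (auto simp: Q_def occurs_at_def n_def)
  then have fin: "finite Q" by (rule finite_subset) simp
  define p q where "p = Min Q" and "q = Max Q"
  have pq: "p \<in> Q" "q \<in> Q" and mm: "\<And>a. a \<in> Q \<Longrightarrow> p \<le> a \<and> a \<le> q"
    using fin \<open>Q \<noteq> {}\<close> by (auto simp: p_def q_def)
  have occ: "occurs_at s u p" "occurs_at s u q" using pq by (auto simp: Q_def)
  have ext_p: "extendable u k p"
    unfolding k_def by (rule first_occurrence_extendable[OF cov occ(1) _ s]) (use mm in \<open>force simp: Q_def\<close>)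
  have qk: "q + k \<le> n" using occ(2) by (simp add: occurs_at_def k_def n_def)
  have cov': "covers (rev s) (rev y @ rev u @ rev x)" using covers_rev[OF cov] by simp
  have "extendable (rev u) (length (rev s)) (n - k - q)"
  proof (rule first_occurrence_extendable[OF cov'])
    show "occurs_at (rev s) (rev u) (n - k - q)"
      using occurs_at_rev[OF occ(2)] by (simp add: n_def k_def)
    show "rev s \<noteq> []" using s by simp
    fix q' assume q': "q' < n - k - q"
    show "\<not> occurs_at (rev s) (rev u) q'"
    proof
      assume "occurs_at (rev s) (rev u) q'"
      from occurs_at_rev[OF this] have "n - k - q' \<in> Q" by (simp add: Q_def n_def k_def)
      with mm q' show False by fastforce
    qed
  qed
  moreover have "\<exists>a. occurs_at s u a \<and> a \<le> c \<and> c < a + k" if c: "p \<le> c" "c \<le> q" for c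
  \<comment> \<open>From \<open>p + k\<close> on, an occurrence that covers \<open>c\<close> starts
    after \<open>p\<close>, hence in \<open>u\<close>; by \<open>c <= q\<close> it starts no later
    than \<open>q\<close>, so it also ends in \<open>u\<close>.\<close>
  proof (cases "c < p + k")
    case True
    with occ c show ?thesis by blast
  next
    case False
    have "length x + c < length (x @ u @ y)" using c qk s[folded length_greater_0_conv]
      unfolding n_def k_def length_append by linarith
    then obtain i where i: "occurs_at s (x @ u @ y) i" "i \<le> length x + c" "length x + c < i + k"
      using cov unfolding covers_def k_def by blast
    have ix: "length x \<le> i" using i False by auto
    have "u ! (i - length x + z) = s ! z" if z: "z < length s" for z
    proof -
      have "i + z = length x + (i - length x + z)" "i - length x + z < length u"
        using ix i(2) z qk c by (auto simp: n_def k_def)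
      then have "(x @ u @ y) ! (i + z) = u ! (i - length x + z)"
        by (simp only: nth_append_length_plus nth_append_left)
      then show ?thesis using i(1) z by (auto simp: occurs_at_iff_nth)
    qed
    then have "occurs_at s u (i - length x)"
      using ix i(2) qk c unfolding occurs_at_iff_nth by (auto simp: n_def k_def)
    then show ?thesis using i ix by (intro exI[of _ "i - length x"]) auto
  qed
  moreover have "\<And>p'. occurs_at s u p' \<Longrightarrow> p \<le> p' \<and> p' \<le> q" using mm by (auto simp: Q_def)
  ultimately show thesis using that occ ext_p mm[OF pq(1)] by (auto simp: k_def)
qed

section \<open>Candidates and the chains of their occurrences\<close>

lemma eqf_occurs_at:
  assumes "length s = k" "occurs_at s u p"
  shows "eqf u p q k \<longleftrightarrow> occurs_at s u q"
  using occurs_at_eqf[OF assms(2)] assms(1) by simp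

text \<open>Occurrences are indexed by the position \<open>t\<close> that is aligned with position \<open>k\<close> of the word
  when the factor starting at \<open>p\<close> is shifted to this occurrence.\<close>

definition occ :: "'a list \<Rightarrow> nat \<Rightarrow> nat \<Rightarrow> nat \<Rightarrow> bool" where
  "occ u k p t \<longleftrightarrow> k \<le> t \<and> eqf u p (t - k + p) k"

text \<open>Among the occurrences before \<open>m\<close>, \<open>l\<close> is the last one that is reached from \<open>k\<close> with gaps at most \<open>k\<close>.\<close>

definition chain :: "'a list \<Rightarrow> nat \<Rightarrow> nat \<Rightarrow> nat \<Rightarrow> nat \<Rightarrow> bool" where
  "chain u k m p l \<longleftrightarrow> occ u k p l \<and> l \<le> max k m \<and>
     (\<forall>x. k \<le> x \<and> x \<le> l \<longrightarrow> (\<exists>t. occ u k p t \<and> t \<le> x \<and> x < t + k)) \<and>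
     (\<forall>t<m. occ u k p t \<longrightarrow> l < t \<longrightarrow> l + k < t)"

text \<open>The chain of \<open>p\<close> ends with the occurrence at \<open>L p - k + p\<close>,
  behind which \<open>n - (L p + p)\<close> letters remain; these can be covered by an overhang iff
  their number is at most \<open>rm\<close>. For a seed, the chain of its first occurrence cannot
  stop before its last one, since a letter would stay uncovered.\<close>

lemma has_seed_of_length_iff:
  fixes u :: "'a list"
  defines "n \<equiv> length u"
  assumes k: "0 < k" "k \<le> n"
    and pm: "\<And>p. p \<le> pm \<longleftrightarrow> extendable u k p"
    and rm: "\<And>p. p \<le> rm \<longleftrightarrow> extendable (rev u) k p"
    and d: "0 < d" "eqf u 0 d (pm + k - d)" "d \<le> k"
    and L: "\<And>p. p \<le> min pm (d - 1) \<Longrightarrow> chain u k (Suc n) p (L p)"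
  shows "has_seed_of_length u k \<longleftrightarrow> (\<exists>p \<le> min pm (d - 1). n \<le> L p + p + rm)"
proof
  assume "has_seed_of_length u k"
  then obtain s where s: "length s = k" "seed s u" by (auto simp: has_seed_of_length_def)
  with k have "s \<noteq> []" by auto
  from seedD[OF s(2) this] obtain p q where pq: "occurs_at s u p" "occurs_at s u q" "p \<le> q"
    and ext: "\<And>p'. occurs_at s u p' \<Longrightarrow> p \<le> p' \<and> p' \<le> q"
    "extendable u k p" "extendable (rev u) k (n - k - q)"
    and mid: "\<And>c. p \<le> c \<Longrightarrow> c \<le> q \<Longrightarrow> \<exists>a. occurs_at s u a \<and> a \<le> c \<and> c < a + k"
    unfolding s(1) n_def by blast
  have p_pm: "p \<le> pm" using ext pm by simp
  have r_rm: "n - k - q \<le> rm" using ext rm by simp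
  note eqs = eqf_occurs_at[OF s(1) pq(1)]
  have pk: "p + k \<le> n" and qk: "q + k \<le> n"
    using pq by (auto simp: occurs_at_def s n_def)
  \<comment> \<open>Otherwise the period \<open>d\<close> of the prefix of length
    \<open>pm + k\<close> moves the factor to \<open>p - d\<close>, and \<open>p\<close> would not
    be its first occurrence.\<close>
  have "p < d"
  proof (rule ccontr)
    assume "\<not> p < d"
    then have "u ! (p - d + x) = u ! (p + x)" if "x < k" for x
      using d(2) p_pm that unfolding eqf_def by (auto dest!: spec[of _ "p - d + x"])
    then have "eqf u p (p - d) k" using \<open>\<not> p < d\<close> pk unfolding eqf_def n_def by auto
    then have "occurs_at s u (p - d)" using eqs by simp
    with ext(1)[of "p - d"] d \<open>\<not> p < d\<close> show False by auto
  qed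
  then have p: "p \<le> min pm (d - 1)" using p_pm by auto
  note ch = L[OF p, unfolded chain_def occ_def eqs]
  have "q \<le> L p - k + p"
  proof (rule ccontr)
    assume c: "\<not> q \<le> L p - k + p"
    have kL: "k \<le> L p" using ch by simp
    have *: "L p + k < a - p + k" if "occurs_at s u a" "L p - k + p < a" for a
    proof -
      have "a + k \<le> n" using that by (simp add: occurs_at_def s n_def)
      moreover have "p \<le> a" using ext(1)[OF that(1)] by simp
      ultimately have "a - p + k < Suc n" "a - p + k - k + p = a" by auto
      moreover have "\<forall>t<Suc n. k \<le> t \<and> occurs_at s u (t - k + p) \<longrightarrow> L p < t \<longrightarrow> L p + k < t"
        using ch by (elim conjE)
      moreover have "k \<le> a - p + k" "L p < a - p + k" using that kL \<open>p \<le> a\<close> by linarith+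
      ultimately show ?thesis using that by metis
    qed
    have "L p + k < q - p + k" using *[OF pq(2)] c by simp
    then have "L p + p \<le> q" by simp
    \<comment> \<open>\<open>L p + p\<close> is the first position behind the last occurrence of the
      chain. Whatever covers it would have to start within the gap that was just excluded.\<close>
    with mid[of "L p + p"] obtain a where a: "occurs_at s u a" "a \<le> L p + p" "L p + p < a + k"
      by auto
    then have "L p - k + p < a" using kL by linarith
    from *[OF a(1) this] a(2) show False by linarith
  qed
  then have "n \<le> L p + p + rm" using r_rm qk ch by auto
  with p show "\<exists>p \<le> min pm (d - 1). n \<le> L p + p + rm" by blast
next
  assume "\<exists>p \<le> min pm (d - 1). n \<le> L p + p + rm"
  then obtain p where p: "p \<le> min pm (d - 1)" "n \<le> L p + p + rm" by blast
  note ch = L[OF p(1), unfolded chain_def]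
  define q where "q = L p - k + p"
  have kL: "k \<le> L p" and "eqf u p q k" using ch by (auto simp: occ_def q_def)
  then have pk: "p + k \<le> n" "q + k \<le> n" by (auto simp: eqf_def n_def)
  define s where "s = take k (drop p u)"
  have s: "length s = k" using pk by (simp add: s_def n_def)
  have occp: "occurs_at s u p" using pk s by (auto simp: occurs_at_def s_def n_def)
  note eqs = eqf_occurs_at[OF s occp]
  have "seed s u"
  proof (rule seedI)
    show "occurs_at s u p" by fact
    show "occurs_at s u q" using eqs \<open>eqf u p q k\<close> by simp
    show "extendable u (length s) p" using p pm s by simp
    have "n - k - q \<le> rm" using p(2) pk kL by (auto simp: q_def)
    then show "extendable (rev u) (length s) (length u - length s - q)" using rm s by (simp add: n_def)
    fix c assume c: "p \<le> c" "c < q + length s"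
    show "\<exists>a. occurs_at s u a \<and> a \<le> c \<and> c < a + length s"
    proof (cases "c - p + k \<le> L p")
      case True
      moreover have "\<forall>x. k \<le> x \<and> x \<le> L p \<longrightarrow> (\<exists>t. occ u k p t \<and> t \<le> x \<and> x < t + k)"
        using ch by (elim conjE)
      moreover have "k \<le> c - p + k" by simp
      ultimately have "\<exists>t. occ u k p t \<and> t \<le> c - p + k \<and> c - p + k < t + k" by blast
      then obtain t where t: "occ u k p t" "t \<le> c - p + k" "c - p + k < t + k" by (elim exE conjE)
      then have "occurs_at s u (t - k + p)" "k \<le> t" unfolding occ_def eqs by blast+
      moreover have "t - k + p \<le> c" "c < t - k + p + length s" using c t(2,3) s \<open>k \<le> t\<close> by linarith+
      ultimately show ?thesis by blast
    next
      case False
      then have "q \<le> c" using c kL by (auto simp: q_def)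
      then show ?thesis using c s \<open>eqf u p q k\<close> eqs by blast
    qed
  qed
  with s show "has_seed_of_length u k" unfolding has_seed_of_length_def by blast
qed

section \<open>Periodicity, the number of occurrences, and their description by common
  extensions\<close>

lemma periodic_gcd:
  fixes f :: "nat \<Rightarrow> 'a"
  assumes a: "\<And>i. f (i + a) = f i" and b: "\<And>i. f (i + b) = f i" and "a \<noteq> 0"
  shows "f (i + gcd a b) = f i"
proof -
  have mult: "g (j + c * x) = g j" if "\<And>j. g (j + c) = g j" for g :: "nat \<Rightarrow> 'a" and c x j
    by (induction x) (auto simp: that add.assoc[symmetric] add.left_commute[of _ c] add.commute[of c])
  obtain x y where xy: "a * x = b * y + gcd a b" using bezout_nat[OF \<open>a \<noteq> 0\<close>] by blast
  have "f (i + gcd a b) = f (i + gcd a b + b * y)" using mult[of f b] b by simp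
  also have "\<dots> = f (i + a * x)" by (simp add: xy ac_simps)
  also have "\<dots> = f i" using mult[of f a] a by simp
  finally show ?thesis .
qed

text \<open>Two equal candidates at distance \<open>g\<close> would make \<open>gcd g d\<close> a period smaller than \<open>d\<close>.\<close>

lemma distinct_candidates:
  assumes d: "0 < d" "eqf u 0 d (m - d)" "d \<le> k" "p' + k \<le> m" "m \<le> length u"
    and min: "\<And>e. 0 < e \<Longrightarrow> e < d \<Longrightarrow> \<not> eqf u 0 e (m - e)"
    and p: "p < p'" "p' < d"
  shows "\<not> eqf u p p' k"
proof
  assume eq: "eqf u p p' k"
  have per: "u ! i = u ! (i + d)" if "i + d < m" for i
    using d(2) that unfolding eqf_def by (auto simp: add.commute)
  \<comment> \<open>The infinite word with period \<open>d\<close> that continues the prefix of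
    length \<open>m\<close>. Working in it avoids all boundary conditions of Fine and Wilf.\<close>
  define f where "f i = u ! (i mod d)" for i
  have fu: "f i = u ! i" if "i < m" for i
    using that
  proof (induction i rule: less_induct)
    case (less i)
    show ?case
    proof (cases "i < d")
      case False
      then have "f i = f (i - d)" by (simp add: f_def le_mod_geq)
      also have "\<dots> = u ! (i - d)" using less False d by auto
      also have "\<dots> = u ! i" using per[of "i - d"] less False by auto
      finally show ?thesis .
    qed (simp add: f_def)
  qed
  define g where "g = p' - p"
  have g: "0 < g" "g < d" "p' = p + g" using p by (auto simp: g_def)
  have fmod: "f (i + j) = f (i mod d + j)" for i j by (simp add: f_def mod_add_left_eq)
  have "f (i + g) = f i" for i
  proof -
    \<comment> \<open>The offset in the window that represents \<open>i\<close>: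
      \<open>p + x\<close> is congruent to \<open>i\<close> modulo \<open>d\<close>, and
      \<open>x < d <= k\<close>, so the equality of the two candidates applies at
      \<open>x\<close>.\<close>
    define x where "x = (i + (d - p mod d)) mod d"
    have x: "x < d" using d by (simp add: x_def)
    have px: "(p + x) mod d = i mod d"
    proof -
      have "(p + x) mod d = (p mod d + (i + (d - p mod d))) mod d"
        unfolding x_def by (metis mod_add_eq mod_mod_trivial)
      also have "p mod d + (i + (d - p mod d)) = i + d" using mod_less_divisor[OF d(1), of p] by linarith
      finally show ?thesis by simp
    qed
    have "f (i + g) = f (p + x + g)" using fmod[of i g] fmod[of "p + x" g] px by simp
    also have "\<dots> = u ! (p' + x)" using x d g by (subst fu) (auto simp: ac_simps)
    also have "\<dots> = u ! (p + x)" using eq x d unfolding eqf_def by auto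
    also have "\<dots> = f (p + x)" using x d g by (subst fu) auto
    also have "\<dots> = f i" using px by (simp add: f_def)
    finally show ?thesis .
  qed
  moreover have "f (i + d) = f i" for i by (simp add: f_def)
  ultimately have fh: "f (i + gcd g d) = f i" for i using g by (intro periodic_gcd) auto
  define h where "h = gcd g d"
  have h: "0 < h" "h < d" using g d
    by (auto simp: h_def) (metis gcd_le1_nat le_less_trans nat_neq_iff)
  have "eqf u 0 h (m - h)"
    unfolding eqf_def
  proof (intro conjI allI impI)
    fix x assume x: "x < m - h"
    show "u ! (0 + x) = u ! (h + x)"
      using fh[of x] fu[of x] fu[of "h + x"] x by (simp add: h_def add.commute)
  qed (use d h in auto)
  with min[OF h] show False by simp
qed

text \<open>Candidate \<open>p\<close> aligned at \<open>t\<close> starts at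
  \<open>t - k + p\<close>. Two candidates starting at the same place would be equal words, so
  \<open>t + p\<close> determines the pair, and \<open>t + p\<close> is at most
  \<open>length u\<close>. This is what makes the enumeration linear.\<close>

lemma sum_card_occ_le:
  assumes k: "0 < k" and "m \<le> length u" "\<And>p. p \<le> b \<Longrightarrow> p + k \<le> m"
    and d: "0 < d" "eqf u 0 d (m - d)" "d \<le> k" "b < d"
    and min: "\<And>e. 0 < e \<Longrightarrow> e < d \<Longrightarrow> \<not> eqf u 0 e (m - e)"
  shows "(\<Sum>t\<in>{k..<j}. card {p. p \<le> b \<and> occ u k p t}) \<le> length u"
proof -
  let ?S = "SIGMA t:{k..<j}. {p. p \<le> b \<and> occ u k p t}"
  have fin: "finite {p. p \<le> b \<and> occ u k p t}" for t by (rule finite_subset[of _ "{..b}"]) auto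
  have *: False if "occ u k p t" "occ u k p' t'" "t + p = t' + p'" "p < p'" "p' \<le> b" for t p t' p'
  proof -
    have "t - k + p = t' - k + p'" using that by (auto simp: occ_def)
    with that(1,2) have "eqf u p p' k" unfolding occ_def eqf_def by auto
    moreover have "p' + k \<le> m" using that assms by simp
    ultimately show False
      using distinct_candidates[OF d(1,2,3) _ assms(2) min, of p' p] that d by auto
  qed
  have "inj_on (\<lambda>(t, p). t + p) ?S"
    by (rule inj_onI) (auto, (metis * nat_neq_iff add_right_cancel)+)
  moreover have "(\<lambda>(t, p). t + p) ` ?S \<subseteq> {k..length u}"
    by (auto simp: occ_def eqf_def)
  ultimately have "card ?S \<le> card {k..length u}" by (intro card_inj_on_le) auto
  also have "\<dots> \<le> length u" using k by simp
  also have "card ?S = (\<Sum>t\<in>{k..<j}. card {p. p \<le> b \<and> occ u k p t})" by (intro card_SigmaI) (auto simp: fin)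
  finally show ?thesis .
qed

text \<open>The cut at \<open>k\<close> divides the candidate into \<open>k - p\<close> letters
  before it and \<open>p\<close> letters from it on; index \<open>length u - k\<close> of
  \<open>rev u\<close> is the letter just before the cut. For fixed \<open>t\<close> both conditions
  bound \<open>p\<close>, one from above and one from below, so the candidates at \<open>t\<close>
  form an interval.\<close>

lemma occ_iff:
  assumes "p \<le> k" "k \<le> t" "t \<le> length u"
  shows "occ u k p t \<longleftrightarrow>
    eqf u k t p \<and> eqf (rev u) (length u - k) (length u - t) (k - p)"
proof
  assume o: "occ u k p t"
  then have e: "\<And>x. x < k \<Longrightarrow> u ! (p + x) = u ! (t - k + p + x)"
    and l: "t - k + p + k \<le> length u" "p + k \<le> length u" by (auto simp: occ_def eqf_def)
  have "u ! (k + x) = u ! (t + x)" if "x < p" for x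
    using e[of "k - p + x"] that assms by auto
  moreover have "rev u ! (length u - k + x) = rev u ! (length u - t + x)" if "x < k - p" for x
    using e[of "k - p - Suc x"] that assms by (simp add: rev_nth)
  ultimately show "eqf u k t p \<and> eqf (rev u) (length u - k) (length u - t) (k - p)"
    using l assms by (auto simp: eqf_def)
next
  assume "eqf u k t p \<and> eqf (rev u) (length u - k) (length u - t) (k - p)"
  then have e: "\<And>x. x < p \<Longrightarrow> u ! (k + x) = u ! (t + x)" "t + p \<le> length u"
    and e': "\<And>x. x < k - p \<Longrightarrow> rev u ! (length u - k + x) = rev u ! (length u - t + x)"
    by (auto simp: eqf_def)
  have "u ! (p + x) = u ! (t - k + p + x)" if x: "x < k" for x
  proof (cases "x < k - p")
    case True
    then show ?thesis using e'[of "k - p - Suc x"] assms by (simp add: rev_nth ac_simps)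
  next
    case False
    then show ?thesis using e(1)[of "x - (k - p)"] assms x by (auto simp: ac_simps)
  qed
  then show "occ u k p t" using e assms by (auto simp: occ_def eqf_def)
qed

text \<open>\<open>p < d\<close> and \<open>p + k - d <= A d\<close> are both upper bounds on
  \<open>p\<close>, so the admissible \<open>p\<close> are those below a maximum over
  \<open>d\<close> that one pass can compute.\<close>

lemma extendable_iff:
  assumes "0 < k" "k \<le> length u"
    and A: "\<And>d l. d \<le> length u \<Longrightarrow> l \<le> length u \<Longrightarrow> l \<le> A d \<longleftrightarrow> eqf u 0 d l"
  shows "extendable u k p \<longleftrightarrow> (\<exists>d. 1 \<le> d \<and> d \<le> k \<and> p \<le> min (d - 1) (A d + d - k))"
proof
  assume "extendable u k p"
  then obtain d where d: "p < d" "d \<le> k" "eqf u 0 d (p + k - d)" unfolding extendable_def by blast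
  then have "p + k - d \<le> A d" using A[of d "p + k - d"] assms by auto
  then show "\<exists>d. 1 \<le> d \<and> d \<le> k \<and> p \<le> min (d - 1) (A d + d - k)"
    using d by (intro exI[of _ d]) auto
next
  assume "\<exists>d. 1 \<le> d \<and> d \<le> k \<and> p \<le> min (d - 1) (A d + d - k)"
  then obtain d where d: "1 \<le> d" "d \<le> k" "p \<le> min (d - 1) (A d + d - k)" by blast
  show "extendable u k p"
  \<comment> \<open>For \<open>A d + d < k\<close> truncated subtraction yields the bound 0 although
    \<open>d\<close> is not suitable. This admits only \<open>p = 0\<close>, which is always
    extendable with \<open>d = k\<close>.\<close>
  proof (cases "p = 0")
    case True
    then show ?thesis using assms unfolding extendable_def eqf_def by (intro exI[of _ k]) auto
  next
    case False
    then have "p + k - d \<le> A d" "p + k - d \<le> length u" "d \<le> length u"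
      using d assms(1,2) by linarith+
    then have "eqf u 0 d (p + k - d)" using A by blast
    then show ?thesis using d False unfolding extendable_def by (intro exI[of _ d]) auto
  qed
qed

section \<open>An imperative language for the word RAM\<close>

datatype loc = V nat | A nat nat

type_synonym store = "loc \<Rightarrow> nat"

datatype bop = Plus | Minus | Times | Over

datatype exp = N nat | X nat | Ar nat exp | In exp | Bop bop exp exp

datatype com =
    Assign nat exp
  | Upd nat exp exp
  | Seq com com (infixr ";;" 60)
  | Cond exp com com
  | While exp com

text \<open>Cells below \<open>nvars\<close> hold the scalar variables, the cells from \<open>nvars\<close> up to \<open>basec\<close>
  are an expression stack, and cell \<open>basec\<close> holds the address \<open>b\<close> behind the input at which
  the \<open>narr\<close> arrays start. The arrays are interleaved, so that none of them needs a size.\<close>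

definition "nvars = (20::nat)"
definition "basec = (40::nat)"
definition "hdr = (41::nat)"
definition "narr = (10::nat)"

abbreviation tmp :: "nat \<Rightarrow> nat" where "tmp d \<equiv> nvars + d"

section \<open>Compilation to machine code\<close>

fun cop :: "bop \<Rightarrow> nat \<Rightarrow> nat \<Rightarrow> nat \<Rightarrow> instr" where
  "cop Plus = Add"
| "cop Minus = Sub"
| "cop Times = Mul"
| "cop Over = Div"

definition caddr :: "nat \<Rightarrow> nat \<Rightarrow> instr list" where
  "caddr d j = [LoadC (tmp (Suc d)) narr, Mul (tmp d) (tmp d) (tmp (Suc d)),
     LoadC (tmp (Suc d)) j, Add (tmp d) (tmp d) (tmp (Suc d)), Add (tmp d) (tmp d) basec]"

text \<open>There is no move instruction, so a scalar is copied by subtracting 0. Unlike an addition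
  this does not reduce modulo \<open>2 ^ w\<close>, so reading a variable carries no size
  condition.\<close>

primrec cexp :: "nat \<Rightarrow> exp \<Rightarrow> instr list" where
  "cexp d (N c) = [LoadC (tmp d) c]"
| "cexp d (X x) = [LoadC (tmp d) 0, Sub (tmp d) x (tmp d)]"
| "cexp d (Ar j e) = cexp d e @ caddr d j @ [Load (tmp d) (tmp d)]"
| "cexp d (In e) = cexp d e @ [LoadC (tmp (Suc d)) 2, Add (tmp d) (tmp d) (tmp (Suc d)),
     Load (tmp d) (tmp d)]"
| "cexp d (Bop f e1 e2) = cexp d e1 @ cexp (Suc d) e2 @ [cop f (tmp d) (tmp d) (tmp (Suc d))]"

primrec esize :: "exp \<Rightarrow> nat" where
  "esize (N c) = 1"
| "esize (X x) = 2"
| "esize (Ar j e) = esize e + 6"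
| "esize (In e) = esize e + 3"
| "esize (Bop f e1 e2) = esize e1 + esize e2 + 1"

lemma length_cexp: "length (cexp d e) = esize e"
  by (induction e arbitrary: d) (auto simp: caddr_def)

primrec csize :: "com \<Rightarrow> nat" where
  "csize (Assign x e) = esize e + 2"
| "csize (Upd j e1 e2) = esize e1 + esize e2 + 6"
| "csize (Seq c1 c2) = csize c1 + csize c2"
| "csize (Cond e c1 c2) = esize e + csize c1 + csize c2 + 2"
| "csize (While e c) = esize e + csize c + 2"

primrec ccom :: "nat \<Rightarrow> com \<Rightarrow> instr list" where
  "ccom p (Assign x e) = cexp 0 e @ [LoadC (tmp 1) 0, Sub x (tmp 0) (tmp 1)]"
| "ccom p (Upd j e1 e2) = cexp 0 e1 @ caddr 0 j @ cexp 1 e2 @ [Store (tmp 0) (tmp 1)]"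
| "ccom p (Seq c1 c2) = ccom p c1 @ ccom (p + csize c1) c2"
| "ccom p (Cond e c1 c2) = cexp 0 e @ [Jz (tmp 0) (p + esize e + csize c1 + 2)] @
     ccom (p + esize e + 1) c1 @ [Jmp (p + esize e + csize c1 + csize c2 + 2)] @
     ccom (p + esize e + csize c1 + 2) c2"
| "ccom p (While e c) = cexp 0 e @ [Jz (tmp 0) (p + esize e + csize c + 2)] @
     ccom (p + esize e + 1) c @ [Jmp p]"

lemma length_ccom: "length (ccom p c) = csize c"
  by (induction c arbitrary: p) (auto simp: length_cexp caddr_def)

primrec wf_exp :: "nat \<Rightarrow> exp \<Rightarrow> bool" where
  "wf_exp d (N c) \<longleftrightarrow> tmp d < basec"
| "wf_exp d (X x) \<longleftrightarrow> tmp d < basec \<and> x < nvars"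
| "wf_exp d (Ar j e) \<longleftrightarrow> wf_exp d e \<and> tmp (Suc d) < basec \<and> j < narr"
| "wf_exp d (In e) \<longleftrightarrow> wf_exp d e \<and> tmp (Suc d) < basec"
| "wf_exp d (Bop f e1 e2) \<longleftrightarrow> wf_exp d e1 \<and> wf_exp (Suc d) e2"

lemma interleave_inject:
  "j < narr \<Longrightarrow> j' < narr \<Longrightarrow> narr * i + j = narr * i' + j' \<longleftrightarrow> i = i' \<and> j = j'"
  by (metis add_left_cancel div_mult_self4 div_less mod_less mod_mult_self4 gr_implies_not0
      add.right_neutral mult.commute)

lemma wf_exp_less: "wf_exp d e \<Longrightarrow> tmp d < basec"
  by (induction e) auto

primrec wf_com :: "com \<Rightarrow> bool" where
  "wf_com (Assign x e) \<longleftrightarrow> wf_exp 0 e \<and> x < nvars"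
| "wf_com (Upd j e1 e2) \<longleftrightarrow> wf_exp 0 e1 \<and> wf_exp 1 e2 \<and> j < narr"
| "wf_com (Seq c1 c2) \<longleftrightarrow> wf_com c1 \<and> wf_com c2"
| "wf_com (Cond e c1 c2) \<longleftrightarrow> wf_exp 0 e \<and> wf_com c1 \<and> wf_com c2"
| "wf_com (While e c) \<longleftrightarrow> wf_exp 0 e \<and> wf_com c"

primrec modifies :: "com \<Rightarrow> loc \<Rightarrow> bool" where
  "modifies (Assign x e) l \<longleftrightarrow> l = V x"
| "modifies (Upd j e1 e2) l \<longleftrightarrow> (\<exists>i. l = A j i)"
| "modifies (Seq c1 c2) l \<longleftrightarrow> modifies c1 l \<or> modifies c2 l"
| "modifies (Cond e c1 c2) l \<longleftrightarrow> modifies c1 l \<or> modifies c2 l"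
| "modifies (While e c) l \<longleftrightarrow> modifies c l"

fun apply_bop :: "bop \<Rightarrow> nat \<Rightarrow> nat \<Rightarrow> nat" where
  "apply_bop Plus a b = a + b"
| "apply_bop Minus a b = a - b"
| "apply_bop Times a b = a * b"
| "apply_bop Over a b = a div b"

definition eff :: "nat \<Rightarrow> instr \<Rightarrow> (nat \<Rightarrow> nat) \<Rightarrow> nat \<Rightarrow> nat" where
  "eff w i m = snd (exec w i (0, m))"

lemma eff_simps [simp]:
  "eff w (LoadC r c) m = m(r := c mod 2 ^ w)"
  "eff w (Add r a b) m = m(r := (m a + m b) mod 2 ^ w)"
  "eff w (Sub r a b) m = m(r := m a - m b)"
  "eff w (Mul r a b) m = m(r := (m a * m b) mod 2 ^ w)"
  "eff w (Div r a b) m = m(r := m a div m b)"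
  "eff w (Load r a) m = m(r := m (m a))"
  "eff w (Store a r) m = m(m a := m r)"
  by (auto simp: eff_def)

fun straight :: "instr \<Rightarrow> bool" where
  "straight (Jz _ _) = False"
| "straight (Jmp _) = False"
| "straight Halt = False"
| "straight _ = True"

lemma exec_straight: "straight i \<Longrightarrow> exec w i (pc, m) = (Suc pc, eff w i m)"
  by (cases i) (auto simp: eff_def)

lemma straight_cop [simp]: "straight (cop f a b c)"
  by (cases f) auto

lemma straight_caddr: "list_all straight (caddr d j)"
  by (simp add: caddr_def)

lemma straight_cexp: "list_all straight (cexp d e)"
  by (induction e arbitrary: d) (auto simp: straight_caddr)

lemma step_at:
  "i \<noteq> Halt \<Longrightarrow> step w (P @ i # R) (length P, m) = exec w i (length P, m)"
  by (simp add: step_def halted_def)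

lemma funpow_trans:
  "(f ^^ s) a = b \<Longrightarrow> (f ^^ t) b = c \<Longrightarrow> (f ^^ (s + t)) a = c"
  by (simp add: funpow_add add.commute[of s])

lemma steps_straight:
  assumes "list_all straight C"
  shows "(step w (P @ C @ R) ^^ length C) (length P, m) = (length P + length C, fold (eff w) C m)"
  using assms
proof (induction C arbitrary: P m)
  case (Cons i C)
  then have "i \<noteq> Halt" by auto
  then have 1: "step w (P @ (i # C) @ R) (length P, m) = (length (P @ [i]), eff w i m)"
    using Cons.prems by (simp add: step_at exec_straight)
  have "(step w ((P @ [i]) @ C @ R) ^^ length C) (length (P @ [i]), eff w i m)
     = (length (P @ [i]) + length C, fold (eff w) C (eff w i m))"
    using Cons by (intro Cons.IH) auto
  then show ?case using 1 by (simp add: funpow_swap1 del: funpow.simps) (simp add: funpow_swap1)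
qed simp

text \<open>\<open>inp\<close> gives the letters as they stood at the start. Only those in the cells
  from \<open>hdr\<close> up to \<open>b\<close> are assumed to survive; the cells below are taken
  over by registers.\<close>

locale ram =
  fixes w :: nat and inp :: "nat \<Rightarrow> nat" and b :: nat
  assumes hdr_le: "hdr \<le> b" and hdr_less: "hdr < 2 ^ w" and b_less: "b < 2 ^ w"
begin

primrec ev :: "exp \<Rightarrow> store \<Rightarrow> nat" where
  "ev (N c) s = c"
| "ev (X x) s = s (V x)"
| "ev (Ar j e) s = s (A j (ev e s))"
| "ev (In e) s = inp (ev e s)"
| "ev (Bop f e1 e2) s = apply_bop f (ev e1 s) (ev e2 s)"

definition fits :: "nat \<Rightarrow> bool" where "fits x \<longleftrightarrow> x < 2 ^ w"

definition fits_idx :: "nat \<Rightarrow> bool" where "fits_idx i \<longleftrightarrow> b + narr * Suc i \<le> 2 ^ w"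

text \<open>Values are unbounded naturals in \<open>ev\<close>, so evaluation is confined to cases
  in which the machine does not wrap around. Only constants, sums, products and addresses can cause
  this.\<close>

primrec ok :: "exp \<Rightarrow> store \<Rightarrow> bool" where
  "ok (N c) s \<longleftrightarrow> fits c"
| "ok (X x) s \<longleftrightarrow> True"
| "ok (Ar j e) s \<longleftrightarrow> ok e s \<and> fits_idx (ev e s)"
| "ok (In e) s \<longleftrightarrow> ok e s \<and> hdr \<le> ev e s + 2 \<and> ev e s + 2 < b"
| "ok (Bop f e1 e2) s \<longleftrightarrow> ok e1 s \<and> ok e2 s \<and>
     (f = Plus \<or> f = Times \<longrightarrow> fits (apply_bop f (ev e1 s) (ev e2 s)))"

text \<open>Nothing is said about the expression stack, so evaluating an expression preserves
  \<open>rep\<close>.\<close>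

definition rep :: "(nat \<Rightarrow> nat) \<Rightarrow> store \<Rightarrow> bool" where
  "rep m s \<longleftrightarrow> (\<forall>x<nvars. m x = s (V x)) \<and>
     (\<forall>j<narr. \<forall>i. m (b + narr * i + j) = s (A j i)) \<and> m basec = b \<and>
     (\<forall>i. hdr \<le> i + 2 \<longrightarrow> i + 2 < b \<longrightarrow> m (i + 2) = inp i)"

lemma rep_cong:
  assumes "rep m s" "\<And>a. \<not> (nvars \<le> a \<and> a < basec) \<Longrightarrow> m' a = m a"
  shows "rep m' s"
  using assms hdr_le unfolding rep_def by (auto simp: nvars_def basec_def hdr_def)

lemma rep_V:
  assumes "rep m s" "x < nvars"
  shows "rep (m(x := v)) (s(V x := v))"
proof -
  have "x \<noteq> basec" "x < b" "x < hdr" using assms(2) hdr_le by (auto simp: nvars_def basec_def hdr_def)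
  then show ?thesis using assms unfolding rep_def by auto
qed

lemma rep_A:
  assumes "rep m s" "j < narr"
  shows "rep (m(b + narr * i + j := v)) (s(A j i := v))"
proof -
  have "b + narr * i' + j' = b + narr * i + j \<longleftrightarrow> i' = i \<and> j' = j" if "j' < narr" for i' j'
    using interleave_inject[OF that assms(2), of i' i] by (simp only: add.assoc add_left_cancel)
  moreover have "basec < b" "nvars < b" using hdr_le by (auto simp: nvars_def basec_def hdr_def)
  ultimately show ?thesis using assms unfolding rep_def by (auto simp del: add_left_cancel)
qed

lemma caddr_correct:
  assumes "m (tmp d) = i" "m basec = b" "fits_idx i" "j < narr" "tmp (Suc d) < basec"
  defines "m' \<equiv> fold (eff w) (caddr d j) m"
  shows "m' (tmp d) = b + narr * i + j" "\<And>a. a \<noteq> tmp d \<Longrightarrow> a \<noteq> tmp (Suc d) \<Longrightarrow> m' a = m a"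
proof -
  have "narr < 2 ^ w" "j < 2 ^ w" using hdr_less assms(4) by (auto simp: narr_def hdr_def)
  moreover have "i * narr < 2 ^ w" "i * narr + j < 2 ^ w" "i * narr + j + b < 2 ^ w"
    using assms(3,4) by (auto simp: fits_idx_def algebra_simps)
  ultimately show "m' (tmp d) = b + narr * i + j"
    using assms by (simp add: m'_def caddr_def algebra_simps)
  show "\<And>a. a \<noteq> tmp d \<Longrightarrow> a \<noteq> tmp (Suc d) \<Longrightarrow> m' a = m a"
    by (simp add: m'_def caddr_def)
qed

text \<open>The frame part is needed for binary operations: the left operand stays in
  \<open>tmp d\<close> because evaluation at depth \<open>Suc d\<close> leaves that cell
  alone.\<close>

lemma cexp_correct:
  assumes "rep m s" "wf_exp d e" "ok e s"
  shows "fold (eff w) (cexp d e) m (tmp d) = ev e s \<and>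
    (\<forall>a. \<not> (tmp d \<le> a \<and> a < basec) \<longrightarrow> fold (eff w) (cexp d e) m a = m a)"
  using assms
proof (induction e arbitrary: d m)
  case (N c)
  then show ?case by (auto simp: fits_def)
next
  case (X x)
  then show ?case by (auto simp: rep_def)
next
  case (Ar j e)
  define m1 where "m1 = fold (eff w) (cexp d e) m"
  have m1: "m1 (tmp d) = ev e s" "\<And>a. \<not> (tmp d \<le> a \<and> a < basec) \<Longrightarrow> m1 a = m a"
    using Ar by (auto simp: m1_def)
  have rep1: "rep m1 s" by (rule rep_cong[OF Ar.prems(1)]) (use m1 in auto)
  define m2 where "m2 = fold (eff w) (caddr d j) m1"
  have m2: "m2 (tmp d) = b + narr * ev e s + j"
    "\<And>a. a \<noteq> tmp d \<Longrightarrow> a \<noteq> tmp (Suc d) \<Longrightarrow> m2 a = m1 a"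
    using caddr_correct[of m1 d "ev e s" j] m1(1) rep1 Ar.prems unfolding m2_def rep_def by auto
  have rep2: "rep m2 s" by (rule rep_cong[OF rep1]) (use m2 Ar.prems in auto)
  have 3: "fold (eff w) (cexp d (Ar j e)) m = m2(tmp d := m2 (m2 (tmp d)))"
    by (simp add: m2_def m1_def)
  have "m2 (b + narr * ev e s + j) = s (A j (ev e s))"
    using rep2 Ar.prems by (auto simp: rep_def)
  then show ?case unfolding 3 using m1 m2 Ar.prems by auto
next
  case (In e)
  define m1 where "m1 = fold (eff w) (cexp d e) m"
  have m1: "m1 (tmp d) = ev e s" "\<And>a. \<not> (tmp d \<le> a \<and> a < basec) \<Longrightarrow> m1 a = m a"
    using In by (auto simp: m1_def)
  have rep1: "rep m1 s" by (rule rep_cong[OF In.prems(1)]) (use m1 in auto)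
  have "2 < (2::nat) ^ w" using hdr_less by (simp add: hdr_def)
  moreover have "ev e s + 2 < 2 ^ w" using In.prems b_less by simp
  ultimately have 3: "fold (eff w) (cexp d (In e)) m =
      m1(tmp (Suc d) := 2, tmp d := m1 (ev e s + 2))"
    using m1(1) In.prems by (auto simp: m1_def[symmetric] fun_eq_iff hdr_def nvars_def basec_def)
  have "m1 (ev e s + 2) = inp (ev e s)"
    using rep1 In.prems by (auto simp: rep_def)
  then show ?case unfolding 3 using m1 In.prems by auto
next
  case (Bop f e1 e2)
  define m1 where "m1 = fold (eff w) (cexp d e1) m"
  have m1: "m1 (tmp d) = ev e1 s" "\<And>a. \<not> (tmp d \<le> a \<and> a < basec) \<Longrightarrow> m1 a = m a"
    using Bop by (auto simp: m1_def)
  have rep1: "rep m1 s" by (rule rep_cong[OF Bop.prems(1)]) (use m1 in auto)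
  define m2 where "m2 = fold (eff w) (cexp (Suc d) e2) m1"
  have m2: "m2 (tmp (Suc d)) = ev e2 s" "\<And>a. \<not> (tmp (Suc d) \<le> a \<and> a < basec) \<Longrightarrow> m2 a = m1 a"
    using Bop.IH(2)[of m1 "Suc d"] Bop.prems rep1 by (auto simp: m2_def)
  have "eff w (cop f (tmp d) (tmp d) (tmp (Suc d))) m2 = m2(tmp d := apply_bop f (ev e1 s) (ev e2 s))"
    using m1(1) m2 Bop.prems(3) by (cases f) (auto simp: fits_def)
  then have 3: "fold (eff w) (cexp d (Bop f e1 e2)) m = m2(tmp d := apply_bop f (ev e1 s) (ev e2 s))"
    by (simp add: m2_def m1_def)
  have d: "tmp d < basec" using Bop.prems wf_exp_less by auto
  have "m2 a = m a" if "\<not> (tmp d \<le> a \<and> a < basec)" for a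
    using m1(2)[OF that] m2(2)[of a] that by linarith
  then show ?case unfolding 3 using d by simp
qed

text \<open>The time is the exact number of machine steps of the compiled code: the test adds one
  for \<open>Jz\<close>, and a further one is due for the \<open>Jmp\<close> after the first branch
  of a conditional or after a loop body.\<close>

inductive big :: "com \<Rightarrow> store \<Rightarrow> nat \<Rightarrow> store \<Rightarrow> bool" where
  Assign: "ok e s \<Longrightarrow> big (Assign x e) s (esize e + 2) (s(V x := ev e s))"
| Upd: "ok e1 s \<Longrightarrow> fits_idx (ev e1 s) \<Longrightarrow> ok e2 s \<Longrightarrow>
    big (Upd j e1 e2) s (esize e1 + esize e2 + 6) (s(A j (ev e1 s) := ev e2 s))"
| Seq: "big c1 s t1 s1 \<Longrightarrow> big c2 s1 t2 s2 \<Longrightarrow> big (c1 ;; c2) s (t1 + t2) s2"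
| CondT: "ok e s \<Longrightarrow> ev e s \<noteq> 0 \<Longrightarrow> big c1 s t s' \<Longrightarrow> big (Cond e c1 c2) s (esize e + 1 + t + 1) s'"
| CondF: "ok e s \<Longrightarrow> ev e s = 0 \<Longrightarrow> big c2 s t s' \<Longrightarrow> big (Cond e c1 c2) s (esize e + 1 + t) s'"
| WhileF: "ok e s \<Longrightarrow> ev e s = 0 \<Longrightarrow> big (While e c) s (esize e + 1) s"
| WhileT: "ok e s \<Longrightarrow> ev e s \<noteq> 0 \<Longrightarrow> big c s t s1 \<Longrightarrow> big (While e c) s1 t' s2 \<Longrightarrow>
    big (While e c) s (esize e + 1 + t + 1 + t') s2"

lemma steps_cexp:
  assumes "rep m s" "wf_exp 0 e" "ok e s"
  shows "\<exists>m'. (step w (P @ cexp 0 e @ R) ^^ esize e) (length P, m) = (length P + esize e, m') \<and>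
    rep m' s \<and> m' (tmp 0) = ev e s"
  using steps_straight[OF straight_cexp[of 0 e], of w P R m] cexp_correct[OF assms]
    rep_cong[OF assms(1), of "fold (eff w) (cexp 0 e) m"]
  by (auto simp: length_cexp)

lemma steps_cond:
  assumes "rep m s" "wf_exp 0 e" "ok e s"
  shows "\<exists>m'. (step w (P @ cexp 0 e @ [Jz (tmp 0) q] @ R) ^^ (esize e + 1)) (length P, m) =
      (if ev e s = 0 then q else length P + esize e + 1, m') \<and> rep m' s"
proof -
  obtain m' where m': "(step w (P @ cexp 0 e @ [Jz (tmp 0) q] @ R) ^^ esize e) (length P, m) =
     (length P + esize e, m')" "rep m' s" "m' (tmp 0) = ev e s"
    using steps_cexp[OF assms, of P "[Jz (tmp 0) q] @ R"] by blast
  have "(step w ((P @ cexp 0 e) @ Jz (tmp 0) q # R) ^^ 1) (length (P @ cexp 0 e), m') =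
      (if ev e s = 0 then q else length P + esize e + 1, m')"
    using m'(3) step_at[of "Jz (tmp 0) q" w "P @ cexp 0 e" R m'] by (simp add: length_cexp)
  from funpow_trans[OF m'(1), of 1] this m'(2) show ?thesis
    by (auto simp: length_cexp)
qed

lemma step_Jmp:
  "(step w (P @ [Jmp q] @ R) ^^ 1) (length P, m) = (q, m)"
  by (simp add: step_at)

text \<open>Jumps are absolute, so code is compiled for its own address \<open>length P\<close>.
  Arbitrary surroundings \<open>P\<close> and \<open>R\<close> let the induction hypotheses speak
  about a part of a larger program.\<close>

theorem ccom_correct:
  assumes "big c s t s'" "wf_com c" "rep m s"
  shows "\<exists>m'. (step w (P @ ccom (length P) c @ R) ^^ t) (length P, m) = (length P + csize c, m') \<and>
    rep m' s'"
  using assms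
proof (induction arbitrary: m P R rule: big.induct)
  case (Assign e s x)
  let ?C = "ccom (length P) (Assign x e)"
  define m1 where "m1 = fold (eff w) (cexp 0 e) m"
  have m1: "m1 (tmp 0) = ev e s" "\<And>a. \<not> (tmp 0 \<le> a \<and> a < basec) \<Longrightarrow> m1 a = m a"
    using cexp_correct[of m s 0 e] Assign by (auto simp: m1_def)
  have rep1: "rep m1 s" by (rule rep_cong[OF Assign.prems(2)]) (use m1 in auto)
  have "list_all straight ?C" by (simp add: straight_cexp)
  from steps_straight[OF this, of w P R m]
  have "(step w (P @ ?C @ R) ^^ (esize e + 2)) (length P, m) =
     (length P + csize (Assign x e), m1(tmp 1 := 0, x := ev e s))"
    using m1 by (simp add: length_cexp m1_def)
  moreover have "rep (m1(tmp 1 := 0)) s"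
    by (rule rep_cong[OF rep1]) (auto simp: nvars_def basec_def)
  then have "rep (m1(tmp 1 := 0, x := ev e s)) (s(V x := ev e s))"
    using Assign.prems by (intro rep_V) auto
  ultimately show ?case by blast
next
  case (Upd e1 s e2 j)
  let ?C = "ccom (length P) (Upd j e1 e2)"
  define m1 where "m1 = fold (eff w) (cexp 0 e1) m"
  have m1: "m1 (tmp 0) = ev e1 s" "\<And>a. \<not> (tmp 0 \<le> a \<and> a < basec) \<Longrightarrow> m1 a = m a"
    using cexp_correct[of m s 0 e1] Upd by (auto simp: m1_def)
  have rep1: "rep m1 s" by (rule rep_cong[OF Upd.prems(2)]) (use m1 in auto)
  define m2 where "m2 = fold (eff w) (caddr 0 j) m1"
  have m2: "m2 (tmp 0) = b + narr * ev e1 s + j"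
    "\<And>a. a \<noteq> tmp 0 \<Longrightarrow> a \<noteq> tmp 1 \<Longrightarrow> m2 a = m1 a"
    using caddr_correct[of m1 0 "ev e1 s" j] m1(1) rep1 Upd unfolding m2_def rep_def
    by (auto simp: nvars_def basec_def)
  have rep2: "rep m2 s" by (rule rep_cong[OF rep1]) (use m2 in \<open>auto simp: nvars_def basec_def\<close>)
  define m3 where "m3 = fold (eff w) (cexp 1 e2) m2"
  have m3: "m3 (tmp 1) = ev e2 s" "\<And>a. \<not> (tmp 1 \<le> a \<and> a < basec) \<Longrightarrow> m3 a = m2 a"
    using cexp_correct[of m2 s 1 e2] rep2 Upd by (auto simp: m3_def)
  have rep3: "rep m3 s" by (rule rep_cong[OF rep2]) (use m3 in auto)
  have "list_all straight ?C" by (simp add: straight_cexp straight_caddr)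
  from steps_straight[OF this, of w P R m] length_ccom[of "length P" "Upd j e1 e2"]
  have "(step w (P @ ?C @ R) ^^ (esize e1 + esize e2 + 6)) (length P, m) =
     (length P + csize (Upd j e1 e2), fold (eff w) ?C m)"
    by (simp only: csize.simps)
  moreover have "fold (eff w) ?C m = m3(m3 (tmp 0) := m3 (tmp 1))"
    by (simp add: m1_def m2_def m3_def)
  ultimately have "(step w (P @ ?C @ R) ^^ (esize e1 + esize e2 + 6)) (length P, m) =
     (length P + csize (Upd j e1 e2), m3(m3 (tmp 0) := m3 (tmp 1)))"
    by (simp only:)
  moreover have "rep (m3(m3 (tmp 0) := m3 (tmp 1))) (s(A j (ev e1 s) := ev e2 s))"
  proof -
    have "m3 (tmp 0) = b + narr * ev e1 s + j" using m3(2)[of "tmp 0"] m2(1) by simp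
    moreover have "j < narr" using Upd.prems(1) by simp
    ultimately show ?thesis using rep_A[OF rep3] m3(1) by simp
  qed
  ultimately show ?case by blast
next
  case (Seq c1 s t1 s1 c2 t2 s2)
  let ?C1 = "ccom (length P) c1" and ?C2 = "ccom (length P + csize c1) c2"
  obtain m1 where m1: "(step w (P @ ?C1 @ ?C2 @ R) ^^ t1) (length P, m) = (length P + csize c1, m1)"
    "rep m1 s1" using Seq.IH(1)[of m P "?C2 @ R"] Seq.prems by auto
  obtain m2 where m2: "(step w ((P @ ?C1) @ ?C2 @ R) ^^ t2) (length P + csize c1, m1) =
      (length P + csize c1 + csize c2, m2)" "rep m2 s2"
    using Seq.IH(2)[of m1 "P @ ?C1" R] Seq.prems m1(2) by (auto simp: length_ccom)
  show ?case using funpow_trans[OF m1(1), of t2] m2 by (auto simp: add.assoc)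
next
  case (CondT e s c1 t s' c2)
  let ?n1 = "length P + esize e + 1" and ?n2 = "length P + esize e + csize c1 + 2"
    and ?n3 = "length P + esize e + csize c1 + csize c2 + 2"
  let ?C1 = "ccom ?n1 c1" and ?C2 = "ccom ?n2 c2"
  obtain m1 where m1: "(step w (P @ cexp 0 e @ [Jz (tmp 0) ?n2] @ ?C1 @ [Jmp ?n3] @ ?C2 @ R) ^^
      (esize e + 1)) (length P, m) = (?n1, m1)" "rep m1 s"
    using steps_cond[of m s e P ?n2 "?C1 @ [Jmp ?n3] @ ?C2 @ R"] CondT by auto
  obtain m2 where m2: "(step w (P @ cexp 0 e @ [Jz (tmp 0) ?n2] @ ?C1 @ [Jmp ?n3] @ ?C2 @ R) ^^ t)
      (?n1, m1) = (?n1 + csize c1, m2)" "rep m2 s'"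
    using CondT.IH[of m1 "P @ cexp 0 e @ [Jz (tmp 0) ?n2]" "[Jmp ?n3] @ ?C2 @ R"] CondT.prems m1(2)
    by (auto simp: length_cexp)
  have m3: "(step w (P @ cexp 0 e @ [Jz (tmp 0) ?n2] @ ?C1 @ [Jmp ?n3] @ ?C2 @ R) ^^ 1)
      (?n1 + csize c1, m2) = (?n3, m2)"
    using step_Jmp[of "P @ cexp 0 e @ [Jz (tmp 0) ?n2] @ ?C1" ?n3 "?C2 @ R" m2]
    by (simp add: length_cexp length_ccom add.assoc)
  show ?case using funpow_trans[OF funpow_trans[OF m1(1) m2(1)] m3] m2(2)
    by (auto simp: ac_simps)
next
  case (CondF e s c2 t s' c1)
  let ?n1 = "length P + esize e + 1" and ?n2 = "length P + esize e + csize c1 + 2"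
    and ?n3 = "length P + esize e + csize c1 + csize c2 + 2"
  let ?C1 = "ccom ?n1 c1" and ?C2 = "ccom ?n2 c2"
  obtain m1 where m1: "(step w (P @ cexp 0 e @ [Jz (tmp 0) ?n2] @ ?C1 @ [Jmp ?n3] @ ?C2 @ R) ^^
      (esize e + 1)) (length P, m) = (?n2, m1)" "rep m1 s"
    using steps_cond[of m s e P ?n2 "?C1 @ [Jmp ?n3] @ ?C2 @ R"] CondF by auto
  obtain m2 where m2: "(step w (P @ cexp 0 e @ [Jz (tmp 0) ?n2] @ ?C1 @ [Jmp ?n3] @ ?C2 @ R) ^^ t)
      (?n2, m1) = (?n2 + csize c2, m2)" "rep m2 s'"
    using CondF.IH[of m1 "P @ cexp 0 e @ [Jz (tmp 0) ?n2] @ ?C1 @ [Jmp ?n3]" R] CondF.prems m1(2)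
    by (auto simp: length_cexp length_ccom ac_simps)
  show ?case using funpow_trans[OF m1(1) m2(1)] m2(2)
    by (auto simp: ac_simps)
next
  case (WhileF e s c)
  then show ?case
    using steps_cond[of m s e P "length P + esize e + csize c + 2"
        "ccom (length P + esize e + 1) c @ [Jmp (length P)] @ R"]
    by (auto simp: ac_simps)
next
  case (WhileT e s c t s1 t' s2)
  let ?n1 = "length P + esize e + 1" and ?n2 = "length P + esize e + csize c + 2"
  let ?C = "ccom ?n1 c"
  obtain m1 where m1: "(step w (P @ cexp 0 e @ [Jz (tmp 0) ?n2] @ ?C @ [Jmp (length P)] @ R) ^^
      (esize e + 1)) (length P, m) = (?n1, m1)" "rep m1 s"
    using steps_cond[of m s e P ?n2 "?C @ [Jmp (length P)] @ R"] WhileT by auto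
  obtain m2 where m2: "(step w (P @ cexp 0 e @ [Jz (tmp 0) ?n2] @ ?C @ [Jmp (length P)] @ R) ^^ t)
      (?n1, m1) = (?n1 + csize c, m2)" "rep m2 s1"
    using WhileT.IH(1)[of m1 "P @ cexp 0 e @ [Jz (tmp 0) ?n2]" "[Jmp (length P)] @ R"]
      WhileT.prems m1(2)
    by (auto simp: length_cexp)
  have m3: "(step w (P @ cexp 0 e @ [Jz (tmp 0) ?n2] @ ?C @ [Jmp (length P)] @ R) ^^ 1)
      (?n1 + csize c, m2) = (length P, m2)"
    using step_Jmp[of "P @ cexp 0 e @ [Jz (tmp 0) ?n2] @ ?C" "length P" R m2]
    by (simp add: length_cexp length_ccom add.assoc)
  obtain m4 where m4: "(step w (P @ cexp 0 e @ [Jz (tmp 0) ?n2] @ ?C @ [Jmp (length P)] @ R) ^^ t')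
      (length P, m2) = (length P + csize (While e c), m4)" "rep m4 s2"
    using WhileT.IH(2)[of m2 P R] WhileT.prems m2(2) by auto
  show ?case using funpow_trans[OF funpow_trans[OF funpow_trans[OF m1(1) m2(1)] m3] m4(1)] m4(2)
    by (auto simp: ac_simps)
qed

section \<open>Weakest preconditions with a clock\<close>

lemma big_unmodified:
  "big c s t s' \<Longrightarrow> \<not> modifies c l \<Longrightarrow> s' l = s l"
  by (induction rule: big.induct) auto

text \<open>The last argument of \<open>wp\<close> and of its postcondition is a clock.\<close>

definition wp :: "com \<Rightarrow> (store \<Rightarrow> nat \<Rightarrow> bool) \<Rightarrow> store \<Rightarrow> nat \<Rightarrow> bool" where
  "wp c Q s T \<longleftrightarrow> (\<exists>s' t. big c s t s' \<and> Q s' (T + t))"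

lemma wp_mono:
  assumes "wp c Q s T"
    and "\<And>s' T'. Q s' T' \<Longrightarrow> (\<And>l. \<not> modifies c l \<Longrightarrow> s' l = s l) \<Longrightarrow> R s' T'"
  shows "wp c R s T"
  using assms big_unmodified unfolding wp_def by blast

lemma wp_Assign: "ok e s \<Longrightarrow> Q (s(V x := ev e s)) (T + (esize e + 2)) \<Longrightarrow> wp (Assign x e) Q s T"
  unfolding wp_def using big.Assign by blast

lemma wp_Upd: "ok e1 s \<Longrightarrow> fits_idx (ev e1 s) \<Longrightarrow> ok e2 s \<Longrightarrow>
    Q (s(A j (ev e1 s) := ev e2 s)) (T + (esize e1 + esize e2 + 6)) \<Longrightarrow> wp (Upd j e1 e2) Q s T"
  unfolding wp_def using big.Upd by blast

lemma wp_Seq: "wp c1 (wp c2 Q) s T \<Longrightarrow> wp (c1 ;; c2) Q s T"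
  unfolding wp_def using big.Seq by (metis add.assoc)

lemma wp_Cond:
  assumes "ok e s" "ev e s \<noteq> 0 \<Longrightarrow> wp c1 (\<lambda>s' T'. Q s' (T' + 1)) s (T + (esize e + 1))"
    "ev e s = 0 \<Longrightarrow> wp c2 Q s (T + (esize e + 1))"
  shows "wp (Cond e c1 c2) Q s T"
proof (cases "ev e s = 0")
  case True
  then show ?thesis using assms big.CondF[OF assms(1) True] unfolding wp_def
    by (metis add.assoc)
next
  case False
  then show ?thesis using assms big.CondT[OF assms(1) False] unfolding wp_def
    by (metis add.assoc)
qed

text \<open>Since the body cannot change the locations it does not modify, they keep their initial
  values; invariants therefore mention only what the loop writes.\<close>

lemma wp_While:
  fixes \<mu> :: "store \<Rightarrow> nat"
  assumes "I s T"
    and step: "\<And>s' T'. I s' T' \<Longrightarrow> (\<And>l. \<not> modifies c l \<Longrightarrow> s' l = s l) \<Longrightarrow>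
      ok e s' \<and> (ev e s' = 0 \<longrightarrow> Q s' (T' + (esize e + 1))) \<and>
      (ev e s' \<noteq> 0 \<longrightarrow>
        wp c (\<lambda>s'' T''. I s'' (T'' + 1) \<and> \<mu> s'' < \<mu> s') s' (T' + (esize e + 1)))"
  shows "wp (While e c) Q s T"
proof -
  have "wp (While e c) Q s' T'" if "I s' T'" "\<And>l. \<not> modifies c l \<Longrightarrow> s' l = s l" for s' T'
    using that
  proof (induction "\<mu> s'" arbitrary: s' T' rule: less_induct)
    case less
    note st = step[OF less.prems]
    show ?case
    proof (cases "ev e s' = 0")
      case True
      then show ?thesis using st big.WhileF unfolding wp_def by blast
    next
      case False
      with st obtain s1 t where 1: "big c s' t s1" "I s1 (T' + (esize e + 1) + t + 1)" "\<mu> s1 < \<mu> s'"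
        unfolding wp_def by blast
      have "wp (While e c) Q s1 (T' + (esize e + 1) + t + 1)"
        using less.hyps[OF 1(3,2)] big_unmodified[OF 1(1)] less.prems(2) by simp
      then obtain s2 t' where 2: "big (While e c) s1 t' s2" "Q s2 (T' + (esize e + 1) + t + 1 + t')"
        unfolding wp_def by blast
      have "big (While e c) s' (esize e + 1 + t + 1 + t') s2"
        using big.WhileT[OF _ False 1(1) 2(1)] st by blast
      with 2(2) show ?thesis unfolding wp_def by (intro exI conjI) (auto simp: add.assoc)
    qed
  qed
  with assms(1) show ?thesis by blast
qed

end

section \<open>The algorithm\<close>

text \<open>With truncated subtraction \<open>1 - x\<close> tests for zero, and applied twice it
  maps every positive number to 1. The expression language has no other source of Booleans.\<close>

definition Lt :: "exp \<Rightarrow> exp \<Rightarrow> exp" where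
  "Lt e f = Bop Minus (N 1) (Bop Minus (N 1) (Bop Minus f e))"

definition And :: "exp \<Rightarrow> exp \<Rightarrow> exp" where
  "And e f = Bop Minus (N 1) (Bop Plus (Bop Minus (N 1) e) (Bop Minus (N 1) f))"

definition Eq :: "exp \<Rightarrow> exp \<Rightarrow> exp" where
  "Eq e f = And (Bop Minus (N 1) (Bop Minus e f)) (Bop Minus (N 1) (Bop Minus f e))"

abbreviation plus_exp (infixl "\<oplus>" 65) where "e \<oplus> f \<equiv> Bop Plus e f"
abbreviation minus_exp (infixl "\<ominus>" 65) where "e \<ominus> f \<equiv> Bop Minus e f"

lemma esize_cond [simp]:
  "esize (Lt e f) = esize e + esize f + 5"
  "esize (And e f) = esize e + esize f + 7"
  "esize (Eq e f) = 2 * esize e + 2 * esize f + 13"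
  by (auto simp: Lt_def And_def Eq_def)

text \<open>Scalars: \<open>0\<close> holds \<open>n\<close> and \<open>1\<close> holds \<open>k\<close>; \<open>2\<close>, \<open>3\<close> and \<open>5\<close> to \<open>9\<close> are scratch; \<open>4\<close> is the
  argument of \<open>lce_com\<close>; \<open>10\<close> and \<open>11\<close> bound the left and right overhang; \<open>12\<close> is the period \<open>d\<close>,
  \<open>13\<close> the largest candidate, \<open>14\<close> the answer. Arrays: \<open>0\<close> is \<open>u\<close>, \<open>1\<close> is \<open>rev u\<close>, \<open>2\<close> and \<open>3\<close>
  are the text and the table of the Z-algorithm, \<open>4\<close> to \<open>7\<close> are longest common extensions, \<open>8\<close> holds the
  ends of the chains.\<close>

definition incr :: "nat \<Rightarrow> com" where
  "incr x = Assign x (X x \<oplus> N 1)"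

definition fill :: "nat \<Rightarrow> exp \<Rightarrow> exp \<Rightarrow> exp \<Rightarrow> com" where
  "fill a off bnd val = Assign 2 (N 0);;
     While (Lt (X 2) bnd) (Upd a (off \<oplus> X 2) val;; incr 2)"

definition zcopy :: com where
  "zcopy = Upd 3 (X 2) (Ar 3 (X 2 \<ominus> X 7))"

definition zextend :: com where
  "zextend = Assign 9 (X 8 \<ominus> X 2);;
     While (And (Lt (X 2 \<oplus> X 9) (X 6)) (Eq (Ar 2 (X 9)) (Ar 2 (X 2 \<oplus> X 9)))) (incr 9);;
     Upd 3 (X 2) (X 9);; Assign 7 (X 2);; Assign 8 (X 2 \<oplus> X 9)"

text \<open>The table includes index \<open>m\<close>, one past the text, because extensions are
  also needed at position \<open>n\<close> of the word. Entry 0 is a default: it is read for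
  \<open>j = n\<close> and \<open>t = 0\<close> only, and must then be small.\<close>

definition zcom :: com where
  "zcom = Upd 3 (N 0) (N 0);; Assign 7 (N 0);; Assign 8 (N 0);; Assign 2 (N 1);;
     While (Lt (X 2) (X 6 \<oplus> N 1))
       (Cond (Lt (Ar 3 (X 2 \<ominus> X 7)) (X 8 \<ominus> X 2)) zcopy zextend;; incr 2)"

text \<open>Stores in \<open>a[t]\<close> the longest common extension of the positions \<open>j\<close> and \<open>t\<close> of the word in
  array \<open>v\<close>, up to a surplus beyond \<open>n - j\<close>: it is read off the Z-table of \<open>drop j v @ v\<close>.\<close>

definition lce_com :: "nat \<Rightarrow> nat \<Rightarrow> com" where
  "lce_com v a = Assign 5 (X 0 \<ominus> X 4);; Assign 6 (X 5 \<oplus> X 0);;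
     fill 2 (N 0) (X 5) (Ar v (X 4 \<oplus> X 2));;
     fill 2 (X 5) (X 0) (Ar v (X 2));;
     zcom;;
     fill a (N 0) (X 0 \<oplus> N 1) (Ar 3 (X 5 \<oplus> X 2))"

lemma modifies_incr [simp]: "modifies (incr x) l \<longleftrightarrow> l = V x"
  by (simp add: incr_def)

lemma modifies_fill [simp]: "modifies (fill a e1 e2 e3) l \<longleftrightarrow> l = V 2 \<or> (\<exists>i. l = A a i)"
  by (auto simp: fill_def)

text \<open>The exact Z-value of position \<open>i\<close> in the first \<open>m\<close> letters of
  \<open>f\<close>; the last conjunct says that the match cannot be prolonged.\<close>

definition zval :: "(nat \<Rightarrow> nat) \<Rightarrow> nat \<Rightarrow> nat \<Rightarrow> nat \<Rightarrow> bool" where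
  "zval f m i z \<longleftrightarrow> i + z \<le> m \<and> (\<forall>x<z. f x = f (i + x)) \<and> (i + z < m \<longrightarrow> f z \<noteq> f (i + z))"

locale seed_ram = ram w inp "n + hdr" for w inp n +
  assumes word_large: "1000 * (n + 2) \<le> 2 ^ w"
begin

section \<open>Verification of the Z-algorithm\<close>

lemma fits_linear [simp]: "x \<le> 100 * (n + 2) \<Longrightarrow> fits x"
  using word_large by (simp add: fits_def)

lemma fits_idx_linear [simp]: "i \<le> 10 * (n + 2) \<Longrightarrow> fits_idx i"
  using word_large unfolding fits_idx_def by (simp add: narr_def hdr_def)

lemma ev_cond [simp]:
  "ev (Lt e f) s = of_bool (ev e s < ev f s)"
  "ev (And e f) s = of_bool (ev e s \<noteq> 0 \<and> ev f s \<noteq> 0)"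
  "ev (Eq e f) s = of_bool (ev e s = ev f s)"
  by (auto simp: Lt_def And_def Eq_def)

lemma ok_cond [simp]:
  "ok (Lt e f) s \<longleftrightarrow> ok e s \<and> ok f s"
  "ok (And e f) s \<longleftrightarrow> ok e s \<and> ok f s"
  "ok (Eq e f) s \<longleftrightarrow> ok e s \<and> ok f s"
  by (auto simp: Lt_def And_def Eq_def)

lemma wp_incr:
  "s (V x) < 100 * (n + 2) \<Longrightarrow> Q (s(V x := Suc (s (V x)))) (T + 6) \<Longrightarrow> wp (incr x) Q s T"
  unfolding incr_def by (rule wp_Assign) auto

text \<open>The expressions are evaluated anew in every round, hence the assumption for all states
  that differ in the counter and the target array. The conclusion frames single cells, because the
  text of the Z-algorithm is assembled by two fills of the same array.\<close>

lemma wp_fill: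
  assumes e: "\<And>s'. (\<And>l. l \<noteq> V 2 \<Longrightarrow> \<forall>i. l \<noteq> A a i \<Longrightarrow> s' l = s l) \<Longrightarrow>
      ok bnd s' \<and> ev bnd s' = m \<and> ok off s' \<and> ev off s' = p \<and>
      (s' (V 2) < m \<longrightarrow> ok val s' \<and> ev val s' = f (s' (V 2)))"
    and p: "p + m \<le> 10 * (n + 2)"
    and Q: "\<And>s' T'. (\<And>i. i < m \<Longrightarrow> s' (A a (p + i)) = f i) \<Longrightarrow>
      (\<And>l. l \<noteq> V 2 \<Longrightarrow> (\<And>i. i < m \<Longrightarrow> l \<noteq> A a (p + i)) \<Longrightarrow> s' l = s l) \<Longrightarrow>
      T' \<le> T + (esize bnd + esize off + esize val + 40) * (m + 1) \<Longrightarrow> Q s' T'"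
  shows "wp (fill a off bnd val) Q s T"
proof -
  define C where "C = esize bnd + esize off + esize val + 40"
  define I where "I = (\<lambda>s' T'. s' (V 2) \<le> m \<and> (\<forall>i < s' (V 2). s' (A a (p + i)) = f i) \<and>
     (\<forall>l. l \<noteq> V 2 \<longrightarrow> (\<forall>i < m. l \<noteq> A a (p + i)) \<longrightarrow> s' l = s l) \<and> T' \<le> T + 3 + C * s' (V 2))"
  show ?thesis
    unfolding fill_def
  proof (intro wp_Seq wp_Assign)
    let ?s = "s(V 2 := ev (N 0) s)"
    show "wp (While (Lt (X 2) bnd) (Upd a (off \<oplus> X 2) val;; incr 2)) Q ?s (T + (esize (N 0) + 2))"
    proof (rule wp_While[where I = I and \<mu> = "\<lambda>s. m - s (V 2)"])
      show "I ?s (T + (esize (N 0) + 2))" by (auto simp: I_def)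
    next
      fix s' T'
      assume I: "I s' T'" and fr: "\<And>l. \<not> modifies (Upd a (off \<oplus> X 2) val;; incr 2) l \<Longrightarrow> s' l = ?s l"
      have e': "ok bnd s' \<and> ev bnd s' = m \<and> ok off s' \<and> ev off s' = p \<and>
        (s' (V 2) < m \<longrightarrow> ok val s' \<and> ev val s' = f (s' (V 2)))"
        by (rule e) (use fr in auto)
      let ?i = "s' (V 2)" and ?T = "T' + (esize (Lt (X 2) bnd) + 1)"
      have stop: "Q s' ?T" if "m \<le> ?i"
        using I that by (intro Q) (auto simp: I_def C_def algebra_simps)
      have step: "wp (Upd a (off \<oplus> X 2) val;; incr 2)
          (\<lambda>s'' T''. I s'' (T'' + 1) \<and> m - s'' (V 2) < m - ?i) s' ?T" if i: "?i < m"
      proof (intro wp_Seq wp_Upd wp_incr)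
        show "I (s'(A a (ev (off \<oplus> X 2) s') := ev val s', V 2 :=
            Suc ((s'(A a (ev (off \<oplus> X 2) s') := ev val s')) (V 2))))
          (?T + (esize (off \<oplus> X 2) + esize val + 6) + 6 + 1) \<and>
          m - (s'(A a (ev (off \<oplus> X 2) s') := ev val s', V 2 :=
            Suc ((s'(A a (ev (off \<oplus> X 2) s') := ev val s')) (V 2)))) (V 2) < m - ?i"
          using I i e' by (auto simp: I_def C_def less_Suc_eq algebra_simps)
      qed (use i e' p in auto)
      show "ok (Lt (X 2) bnd) s' \<and> (ev (Lt (X 2) bnd) s' = 0 \<longrightarrow> Q s' ?T) \<and>
        (ev (Lt (X 2) bnd) s' \<noteq> 0 \<longrightarrow> wp (Upd a (off \<oplus> X 2) val;; incr 2)
          (\<lambda>s'' T''. I s'' (T'' + 1) \<and> m - s'' (V 2) < m - ?i) s' ?T)"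
        using e' stop step by auto
    qed
  qed auto
qed

text \<open>\<open>V 7\<close> and \<open>V 8\<close> delimit the matching segment that ends furthest to the right; \<open>g\<close> pays for the
  letter comparisons, since each success moves the end of this segment.\<close>

definition zinv :: "(nat \<Rightarrow> nat) \<Rightarrow> nat \<Rightarrow> nat \<Rightarrow> store \<Rightarrow> nat \<Rightarrow> bool" where
  "zinv f m T s' T' \<longleftrightarrow> s' (V 6) = m \<and> (\<forall>i. s' (A 2 i) = f i) \<and>
     1 \<le> s' (V 2) \<and> s' (V 2) \<le> m + 1 \<and> s' (A 3 0) = 0 \<and>
     (\<forall>i. 1 \<le> i \<and> i < s' (V 2) \<longrightarrow> zval f m i (s' (A 3 i))) \<and>
     s' (V 7) < s' (V 2) \<and> s' (V 8) \<le> m \<and> (s' (V 2) < s' (V 8) \<longrightarrow> 1 \<le> s' (V 7)) \<and>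
     (\<forall>x. s' (V 7) \<le> x \<and> x < s' (V 8) \<longrightarrow> f x = f (x - s' (V 7))) \<and>
     (\<exists>g. (g \<le> s' (V 2) \<or> g \<le> s' (V 8)) \<and> T' \<le> T + 30 + 300 * s' (V 2) + 100 * g)"

lemma zinv_mono: "zinv f m T s' T' \<Longrightarrow> T'' \<le> T' \<Longrightarrow> zinv f m T s' T''"
  unfolding zinv_def by (elim conjE exE, intro conjI) auto

text \<open>Inside the matching segment the text repeats with shift \<open>V 7\<close>. As the
  earlier Z-value ends strictly before the segment does, its mismatching letter is shifted along
  with it, so the value is exact. The invariant is stated for the counter already increased; 34 is
  the cost of the two tests before, and 60 leaves room for the increment and jumps after.\<close>

lemma wp_zcopy:
  assumes I: "zinv f m T s' T'" and i: "s' (V 2) \<le> m" and m: "m \<le> 2 * n"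
    and c: "s' (A 3 (s' (V 2) - s' (V 7))) < s' (V 8) - s' (V 2)"
  shows "wp zcopy (\<lambda>s'' T''. zinv f m T (s''(V 2 := Suc (s'' (V 2)))) (T'' + 60) \<and> s'' (V 2) = s' (V 2))
    s' (T' + 34)"
proof -
  let ?i = "s' (V 2)" and ?l = "s' (V 7)" and ?r = "s' (V 8)"
  let ?z = "s' (A 3 (?i - ?l))"
  have li: "1 \<le> ?l" "?l < ?i" using I c by (auto simp: zinv_def)
  then have "1 \<le> ?i - ?l" "?i - ?l < ?i" by linarith+
  then have z: "zval f m (?i - ?l) ?z" using I by (auto simp: zinv_def)
  have per: "\<And>x. ?l \<le> x \<Longrightarrow> x < ?r \<Longrightarrow> f x = f (x - ?l)" and r: "?r \<le> m"
    using I by (auto simp: zinv_def)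
  have sh: "f (?i + x) = f (?i - ?l + x)" if "x \<le> ?z" for x
    using per[of "?i + x"] that c li by auto
  have zi: "zval f m ?i ?z"
    unfolding zval_def
  proof (intro conjI allI impI)
    show "?i + ?z \<le> m" using c r by linarith
    show "f x = f (?i + x)" if "x < ?z" for x
      using z that sh[of x] by (auto simp: zval_def)
    show "f ?z \<noteq> f (?i + ?z)" if "?i + ?z < m"
      using z that sh[of ?z] li by (auto simp: zval_def)
  qed
  obtain g where g: "g \<le> ?i \<or> g \<le> ?r" "T' \<le> T + 30 + 300 * ?i + 100 * g"
    using I by (auto simp: zinv_def)
  have "g \<le> Suc ?i \<or> g \<le> ?r" "T' + 129 \<le> T + 30 + 300 * Suc ?i + 100 * g"
    using g by auto
  then have ex: "\<exists>g. (g \<le> Suc ?i \<or> g \<le> ?r) \<and> T' + 129 \<le> T + 30 + 300 * Suc ?i + 100 * g"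
    by (intro exI[of _ g]) auto
  let ?s = "(s'(A 3 ?i := ?z))(V 2 := Suc ?i)"
  have "zinv f m T ?s (T' + 129)"
    unfolding zinv_def
  proof (intro conjI)
    show "\<forall>j. 1 \<le> j \<and> j < ?s (V 2) \<longrightarrow> zval f m j (?s (A 3 j))"
      using I zi by (auto simp: zinv_def less_Suc_eq)
  qed (use I i ex li in \<open>simp_all add: zinv_def\<close>)
  moreover have "?i \<le> 10 * (n + 2)" using i m by simp
  ultimately show ?thesis
    unfolding zcopy_def by (intro wp_Upd) (auto elim!: zinv_mono)
qed

text \<open>Here the earlier Z-value reaches at least to the end of the segment, so the first
  \<open>V 8 - V 2\<close> letters are known to match and comparisons start behind them. If the
  segment ends before \<open>V 2\<close>, truncation makes them start at 0.\<close>

lemma wp_zextend: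
  assumes I: "zinv f m T s' T'" and i: "s' (V 2) \<le> m" and m: "m \<le> 2 * n"
    and c: "\<not> s' (A 3 (s' (V 2) - s' (V 7))) < s' (V 8) - s' (V 2)"
  shows "wp zextend (\<lambda>s'' T''. zinv f m T (s''(V 2 := Suc (s'' (V 2)))) (T'' + 60) \<and> s'' (V 2) = s' (V 2))
    s' (T' + 34)"
proof -
  let ?i = "s' (V 2)" and ?l = "s' (V 7)" and ?r = "s' (V 8)"
  let ?Q = "\<lambda>s'' T''. zinv f m T (s''(V 2 := Suc (s'' (V 2)))) (T'' + 60) \<and> s'' (V 2) = s' (V 2)"
  let ?cond = "And (Lt (X 2 \<oplus> X 9) (X 6)) (Eq (Ar 2 (X 9)) (Ar 2 (X 2 \<oplus> X 9)))"
  define J where "J = (\<lambda>s'' T''. (\<forall>l. l \<noteq> V 9 \<longrightarrow> s'' l = s' l) \<and> ?i + s'' (V 9) \<le> m \<and>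
    (\<forall>x < s'' (V 9). f x = f (?i + x)) \<and>
    T'' \<le> T + 90 + 300 * ?i + 100 * (?i + s'' (V 9)))"
  obtain g where g: "g \<le> ?i \<or> g \<le> ?r" "T' \<le> T + 30 + 300 * ?i + 100 * g"
    using I by (auto simp: zinv_def)
  \<comment> \<open>\<open>?i + (?r - ?i)\<close> is the maximum of \<open>?i\<close> and
    \<open>?r\<close>, which is exactly where the comparisons start, so the time spent so far is
    already paid for.\<close>
  have g2: "T' \<le> T + 30 + 300 * ?i + 100 * (?i + (?r - ?i))"
    using g(2) mult_le_mono2[of g "?i + (?r - ?i)" 100] g(1) by linarith
  have r: "?r \<le> m" using I by (simp add: zinv_def)
  have J0: "f x = f (?i + x)" if x: "x < ?r - ?i" for x
  proof -
    have l: "1 \<le> ?l" "?l < ?i" "f (?i + x) = f (?i + x - ?l)"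
      using x I by (auto simp: zinv_def)
    then have "zval f m (?i - ?l) (s' (A 3 (?i - ?l)))" using I by (auto simp: zinv_def)
    then have "f x = f (?i - ?l + x)" using x c by (simp add: zval_def)
    with l show ?thesis by simp
  qed
  show ?thesis
    unfolding zextend_def
  proof (rule wp_Seq, rule wp_Assign, simp, rule wp_Seq,
      rule wp_While[where I = J and \<mu> = "\<lambda>s''. m - s'' (V 9)"])
    show "J (s'(V 9 := ev (X 8 \<ominus> X 2) s')) (T' + 34 + (esize (X 8 \<ominus> X 2) + 2))"
      unfolding J_def
    proof (intro conjI)
      show "?i + (s'(V 9 := ev (X 8 \<ominus> X 2) s')) (V 9) \<le> m" using r i by simp
    qed (use J0 g2 in simp_all)
  next
    fix s2 T2 assume J: "J s2 T2"
    have e: "s2 (V 2) = ?i" "s2 (V 6) = m" "\<And>i. s2 (A 2 i) = f i" "s2 (A 3 0) = 0"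
      "\<And>i. s2 (A 3 i) = s' (A 3 i)"
      using J I by (auto simp: J_def zinv_def)
    let ?z = "s2 (V 9)"
    have iz: "?i + ?z \<le> m" and fz: "\<And>x. x < ?z \<Longrightarrow> f x = f (?i + x)"
      and T2: "T2 \<le> T + 90 + 300 * ?i + 100 * (?i + ?z)" using J by (auto simp: J_def)
    have okc: "ok ?cond s2" using iz e m by simp
    have evc: "ev ?cond s2 = of_bool (?i + ?z < m \<and> f ?z = f (?i + ?z))"
      using e by simp
    have more: "wp (incr 9) (\<lambda>s'' T''. J s'' (T'' + 1) \<and> m - s'' (V 9) < m - ?z) s2
        (T2 + (esize ?cond + 1))" if c: "?i + ?z < m" "f ?z = f (?i + ?z)"
    proof (rule wp_incr)
      show "s2 (V 9) < 100 * (n + 2)" using iz m by simp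
      show "J (s2(V 9 := Suc ?z)) (T2 + (esize ?cond + 1) + 6 + 1) \<and>
        m - (s2(V 9 := Suc ?z)) (V 9) < m - ?z"
        using J c T2 unfolding J_def by (auto simp: less_Suc_eq)
    qed
    have leave: "wp (Upd 3 (X 2) (X 9);; Assign 7 (X 2);; Assign 8 (X 2 \<oplus> X 9)) ?Q s2
        (T2 + (esize ?cond + 1))" if "\<not> (?i + ?z < m \<and> f ?z = f (?i + ?z))"
    proof -
      have zi: "zval f m ?i ?z" using iz fz that by (auto simp: zval_def)
      have sh: "f x = f (x - ?i)" if "?i \<le> x" "x < ?i + ?z" for x
        using fz[of "x - ?i"] that by auto
      let ?s = "s2(A 3 ?i := ?z, V 7 := ?i, V 8 := ?i + ?z)"
      have "zinv f m T (?s(V 2 := Suc (?s (V 2)))) (T2 + 152)"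
        unfolding zinv_def
      proof (intro conjI)
        show "\<forall>j. 1 \<le> j \<and> j < (?s(V 2 := Suc (?s (V 2)))) (V 2) \<longrightarrow>
            zval f m j ((?s(V 2 := Suc (?s (V 2)))) (A 3 j))"
          using I zi e by (auto simp: zinv_def less_Suc_eq)
        show "\<exists>g. (g \<le> (?s(V 2 := Suc (?s (V 2)))) (V 2) \<or> g \<le> (?s(V 2 := Suc (?s (V 2)))) (V 8)) \<and>
            T2 + 152 \<le> T + 30 + 300 * (?s(V 2 := Suc (?s (V 2)))) (V 2) + 100 * g"
          using T2 e(1) by (intro exI[of _ "?i + ?z"]) simp
      qed (use I i iz sh e in \<open>simp_all add: zinv_def\<close>)
      moreover have "?i \<le> 10 * (n + 2)" "?i + ?z \<le> 100 * (n + 2)" using i iz m by simp_all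
      ultimately show ?thesis
        by (intro wp_Seq wp_Upd wp_Assign) (auto simp: e(1) elim!: zinv_mono)
    qed
    show "ok ?cond s2 \<and>
      (ev ?cond s2 = 0 \<longrightarrow> wp (Upd 3 (X 2) (X 9);; Assign 7 (X 2);; Assign 8 (X 2 \<oplus> X 9)) ?Q s2
        (T2 + (esize ?cond + 1))) \<and>
      (ev ?cond s2 \<noteq> 0 \<longrightarrow> wp (incr 9) (\<lambda>s'' T''. J s'' (T'' + 1) \<and> m - s'' (V 9) < m - ?z) s2
        (T2 + (esize ?cond + 1)))"
      using okc evc more leave by (simp only: of_bool_eq_0_iff) blast
  qed
qed

lemma wp_zcom:
  assumes m: "s (V 6) = m" "m \<le> 2 * n"
    and Q: "\<And>s' T'. (\<And>i. 1 \<le> i \<Longrightarrow> i \<le> m \<Longrightarrow> zval (\<lambda>i. s (A 2 i)) m i (s' (A 3 i))) \<Longrightarrow>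
      s' (A 3 0) = 0 \<Longrightarrow> (\<And>l. \<not> modifies zcom l \<Longrightarrow> s' l = s l) \<Longrightarrow>
      T' \<le> T + 1000 * (n + 1) \<Longrightarrow> Q s' T'"
  shows "wp zcom Q s T"
proof (rule wp_mono[where Q = "\<lambda>s' T'. (\<forall>i. 1 \<le> i \<and> i \<le> m \<longrightarrow> zval (\<lambda>i. s (A 2 i)) m i (s' (A 3 i))) \<and>
    s' (A 3 0) = 0 \<and> T' \<le> T + 1000 * (n + 1)"])
  define f where "f = (\<lambda>i. s (A 2 i))"
  let ?cond = "Lt (Ar 3 (X 2 \<ominus> X 7)) (X 8 \<ominus> X 2)"
  let ?body = "Cond ?cond zcopy zextend;; incr 2"
  let ?Q = "\<lambda>s' T'. (\<forall>i. 1 \<le> i \<and> i \<le> m \<longrightarrow> zval f m i (s' (A 3 i))) \<and>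
    s' (A 3 0) = 0 \<and> T' \<le> T + 1000 * (n + 1)"
  have main: "wp (While (Lt (X 2) (X 6 \<oplus> N 1)) ?body) ?Q s0 T0" if "zinv f m T s0 T0" for s0 T0
  proof (rule wp_While[where I = "zinv f m T" and \<mu> = "\<lambda>s. m + 1 - s (V 2)"])
    show "zinv f m T s0 T0" by fact
  next
    fix s' T' assume I: "zinv f m T s' T'"
    let ?i = "s' (V 2)"
    let ?T = "T' + (esize (Lt (X 2) (X 6 \<oplus> N 1)) + 1)"
    obtain g where g: "g \<le> ?i \<or> g \<le> s' (V 8)" "T' \<le> T + 30 + 300 * ?i + 100 * g"
      and b: "?i \<le> m + 1" "s' (V 8) \<le> m" and e: "s' (V 6) = m" and li: "s' (V 7) < ?i"
      using I by (auto simp: zinv_def)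
    have fin: "?Q s' ?T" if "\<not> ?i < m + 1"
    proof (intro conjI)
      have "g \<le> m + 1" using g(1) b by linarith
      then show "?T \<le> T + 1000 * (n + 1)" using g(2) b m that by simp
    qed (use I that in \<open>auto simp: zinv_def\<close>)
    have step: "wp ?body (\<lambda>s'' T''. zinv f m T s'' (T'' + 1) \<and> m + 1 - s'' (V 2) < m + 1 - ?i) s' ?T"
      if i: "?i < m + 1"
    proof (rule wp_Seq, rule wp_Cond)
      show "ok ?cond s'" using b m by simp
      have more: "wp (incr 2) (\<lambda>s'' T''. zinv f m T s'' (T'' + 1) \<and> m + 1 - s'' (V 2) < m + 1 - ?i) s1 T1"
        if "zinv f m T (s1(V 2 := Suc (s1 (V 2)))) (T0 + 60)" "s1 (V 2) = ?i" "T1 \<le> T0 + 53" for s1 T0 T1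
      proof (rule wp_incr)
        show "s1 (V 2) < 100 * (n + 2)" using i m that by simp
        have "zinv f m T (s1(V 2 := Suc (s1 (V 2)))) (T1 + 6 + 1)"
          by (rule zinv_mono[OF that(1)]) (use that in simp)
        then show "zinv f m T (s1(V 2 := Suc (s1 (V 2)))) (T1 + 6 + 1) \<and>
           m + 1 - (s1(V 2 := Suc (s1 (V 2)))) (V 2) < m + 1 - ?i" using that i by simp
      qed
      have T: "?T + (esize ?cond + 1) = T' + 34" by simp
      show "wp zcopy (\<lambda>s'' T''. wp (incr 2)
         (\<lambda>s'' T''. zinv f m T s'' (T'' + 1) \<and> m + 1 - s'' (V 2) < m + 1 - ?i) s'' (T'' + 1))
         s' (?T + (esize ?cond + 1))" if "ev ?cond s' \<noteq> 0"
        unfolding T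
        by (rule wp_mono[OF wp_zcopy[OF I _ m(2)]], use i in simp, use that in simp, rule more) auto
      show "wp zextend (wp (incr 2)
         (\<lambda>s'' T''. zinv f m T s'' (T'' + 1) \<and> m + 1 - s'' (V 2) < m + 1 - ?i))
         s' (?T + (esize ?cond + 1))" if "ev ?cond s' = 0"
        unfolding T
        by (rule wp_mono[OF wp_zextend[OF I _ m(2)]], use i in simp, use that in simp, rule more) auto
    qed
    show "ok (Lt (X 2) (X 6 \<oplus> N 1)) s' \<and> (ev (Lt (X 2) (X 6 \<oplus> N 1)) s' = 0 \<longrightarrow> ?Q s' ?T) \<and>
       (ev (Lt (X 2) (X 6 \<oplus> N 1)) s' \<noteq> 0 \<longrightarrow>
         wp ?body (\<lambda>s'' T''. zinv f m T s'' (T'' + 1) \<and> m + 1 - s'' (V 2) < m + 1 - ?i) s' ?T)"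
      using e m fin step by auto
  qed
  show "wp zcom (\<lambda>s' T'. (\<forall>i. 1 \<le> i \<and> i \<le> m \<longrightarrow> zval (\<lambda>i. s (A 2 i)) m i (s' (A 3 i))) \<and>
    s' (A 3 0) = 0 \<and> T' \<le> T + 1000 * (n + 1)) s T"
    unfolding zcom_def f_def[symmetric]
    by (intro wp_Seq wp_Assign wp_Upd main) (use m in \<open>auto simp: zinv_def f_def\<close>)
qed (use Q in auto)

end

section \<open>Updating chains, and reading extensions off the Z-table\<close>

lemma chain_init:
  assumes "0 < k" "p + k \<le> length u"
  shows "chain u k k p k"
  using assms unfolding chain_def occ_def eqf_def by (auto intro!: exI[of _ k])

text \<open>Once an occurrence comes more than \<open>k\<close> after \<open>l\<close>, all later
  ones do too, so the chain is broken for good and keeps its end without any flag.\<close>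

lemma chain_step:
  assumes "0 < k" "k \<le> t" "chain u k t p l"
  shows "chain u k (Suc t) p (if occ u k p t \<and> t \<le> l + k then t else l)"
proof (cases "occ u k p t \<and> t \<le> l + k")
  case True
  have "\<exists>t'. occ u k p t' \<and> t' \<le> x \<and> x < t' + k" if x: "k \<le> x" "x \<le> t" for x
  proof -
    consider "x \<le> l" | "l < x" "x < t" | "x = t" using x by linarith
    then show ?thesis
    proof cases
      case 1
      then show ?thesis using assms(3) x by (auto simp: chain_def)
    next
      case 2
      then have "x < l + k" using True by linarith
      then show ?thesis using 2 assms(3) unfolding chain_def by (intro exI[of _ l]) auto
    next
      case 3
      then show ?thesis using True assms(1) by (intro exI[of _ t]) auto
    qed
  qed
  then show ?thesis using True unfolding chain_def by auto
next
  case False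
  then show ?thesis using assms(2,3) by (auto simp: chain_def less_Suc_eq)
qed

text \<open>Position \<open>n - j + t\<close> of the concatenation is position \<open>t\<close> of
  \<open>x\<close>. For \<open>l <= n - j\<close> the prefix side of the comparison stays within
  \<open>drop j x\<close>, so no separator is required between the two parts.\<close>

lemma zval_eqf:
  assumes "length x = n" "j \<le> n" "t \<le> n" "l \<le> n - j"
    and "1 \<le> n - j + t \<Longrightarrow> zval ((!) (drop j x @ x)) (n - j + n) (n - j + t) z"
  shows "l \<le> z \<longleftrightarrow> eqf x j t l"
\<comment> \<open>Index 0 of the table carries no Z-value, but then \<open>j = n\<close> and only
  \<open>l = 0\<close> is asked for.\<close>
proof (cases "n - j + t = 0")
  case True
  then show ?thesis using assms by (auto simp: eqf_def)
next
  case False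
  let ?f = "(!) (drop j x @ x)"
  have z: "n - j + t + z \<le> n - j + n" "\<And>y. y < z \<Longrightarrow> ?f y = ?f (n - j + t + y)"
    "n - j + t + z < n - j + n \<Longrightarrow> ?f z \<noteq> ?f (n - j + t + z)"
    using assms(5) False unfolding zval_def by auto
  have f1: "?f y = x ! (j + y)" if "y < n - j" for y
    using that assms by (simp add: nth_append)
  have f2: "?f (n - j + t + y) = x ! (t + y)" for y
    using nth_append_length_plus[of "drop j x" x "t + y"] assms(1) by (simp add: add.assoc)
  show ?thesis
  proof
    assume l: "l \<le> z"
    have "x ! (j + y) = x ! (t + y)" if "y < l" for y
      using z(2)[of y] f1[of y] f2[of y] that l assms(4) by simp
    then show "eqf x j t l" using l z(1) assms by (auto simp: eqf_def)
  next
    assume e: "eqf x j t l"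
    show "l \<le> z"
    proof (rule ccontr)
      assume "\<not> l \<le> z"
      then have "z < l" by simp
      then have "x ! (j + z) = x ! (t + z)" "t + z < n" using e assms by (auto simp: eqf_def)
      then have "n - j + t + z < n - j + n" "z < n - j" using \<open>z < l\<close> assms(4) by linarith+
      then show False using z(3) f1[of z] f2[of z] \<open>x ! (j + z) = x ! (t + z)\<close> by metis
    qed
  qed
qed

text \<open>Under truncated subtraction \<open>y - (y - z)\<close> is the minimum of
  \<open>y\<close> and \<open>z\<close>, and \<open>x + (y - x)\<close> is the maximum of
  \<open>x\<close> and \<open>y\<close>.\<close>

definition max_com :: "nat \<Rightarrow> nat \<Rightarrow> com" where
  "max_com a x = Assign x (N 0);; Assign 2 (N 1);;
     While (Lt (X 2) (X 1 \<oplus> N 1))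
       (Assign 9 ((Ar a (X 2) \<oplus> X 2) \<ominus> X 1);;
        Assign x (X x \<oplus> ((X 9 \<ominus> (X 9 \<ominus> (X 2 \<ominus> N 1))) \<ominus> X x));;
        incr 2)"

text \<open>The prefix of length \<open>pm + k\<close> has period \<open>d\<close> iff the extension
  of positions 0 and \<open>d\<close> has length at least \<open>pm + k - d\<close>, so the first
  \<open>d\<close> that passes the test is the least period.\<close>

definition period_com :: com where
  "period_com = Assign 12 (N 1);; While (Lt (Ar 4 (X 12) \<oplus> X 12) (X 10 \<oplus> X 1)) (incr 12);;
     Assign 13 (X 10 \<ominus> (X 10 \<ominus> (X 12 \<ominus> N 1)))"

text \<open>The assignment to the scratch variable \<open>9\<close> stands for doing nothing.
  Candidates with a broken chain are still visited; this is affordable because all occurrences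
  together are at most \<open>n\<close>.\<close>

definition mark_body :: com where
  "mark_body = Assign 2 (X 1 \<ominus> Ar 7 (X 0 \<ominus> X 3));;
     While (And (Lt (X 2) (Ar 6 (X 3) \<oplus> N 1)) (Lt (X 2) (X 13 \<oplus> N 1)))
       (Cond (Lt (X 1) (X 3 \<ominus> Ar 8 (X 2))) (Assign 9 (N 0)) (Upd 8 (X 2) (X 3));; incr 2)"

definition mark_com :: com where
  "mark_com = Assign 3 (X 1);; While (Lt (X 3) (X 0 \<oplus> N 1)) (mark_body;; incr 3)"

definition answer_com :: com where
  "answer_com = Assign 14 (N 0);; Assign 2 (N 0);;
     While (Lt (X 2) (X 13 \<oplus> N 1))
       (Cond (Lt ((Ar 8 (X 2) \<oplus> X 2) \<oplus> X 11) (X 0)) (Assign 9 (N 0)) (Assign 14 (N 1));; incr 2);;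
     Assign 0 (X 14)"

context seed_ram
begin

section \<open>Verification of the stages\<close>

lemma wp_lce:
  assumes s: "s (V 0) = n" "s (V 4) = j" "j \<le> n" "length x = n"
      "\<And>i. i < n \<Longrightarrow> s (A v i) = x ! i" "v \<noteq> 2" "v \<noteq> 3" "a \<noteq> 3"
    and Q: "\<And>s' T'. (\<And>t l. t \<le> n \<Longrightarrow> l \<le> n - j \<Longrightarrow> l \<le> s' (A a t) \<longleftrightarrow> eqf x j t l) \<Longrightarrow>
      (\<And>t. t \<le> n \<Longrightarrow> s' (A a t) \<le> 2 * n) \<Longrightarrow>
      (\<And>l. \<not> modifies (lce_com v a) l \<Longrightarrow> s' l = s l) \<Longrightarrow>
      T' \<le> T + 3000 * (n + 1) \<Longrightarrow> Q s' T'"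
  shows "wp (lce_com v a) Q s T"
proof (rule wp_mono[where Q = "\<lambda>s' T'. (\<forall>t l. t \<le> n \<longrightarrow> l \<le> n - j \<longrightarrow> l \<le> s' (A a t) \<longleftrightarrow> eqf x j t l) \<and>
    (\<forall>t\<le>n. s' (A a t) \<le> 2 * n) \<and> T' \<le> T + 3000 * (n + 1)"])
  let ?Q = "\<lambda>s' T'. (\<forall>t l. t \<le> n \<longrightarrow> l \<le> n - j \<longrightarrow> l \<le> s' (A a t) \<longleftrightarrow> eqf x j t l) \<and>
    (\<forall>t\<le>n. s' (A a t) \<le> 2 * n) \<and> T' \<le> T + 3000 * (n + 1)"
  let ?s0 = "s(V 5 := n - j, V 6 := n - j + n)"
  let ?m = "n - j + n"
  have "wp (fill 2 (N 0) (X 5) (Ar v (X 4 \<oplus> X 2)))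
     (wp (fill 2 (X 5) (X 0) (Ar v (X 2));; zcom;; fill a (N 0) (X 0 \<oplus> N 1) (Ar 3 (X 5 \<oplus> X 2))) ?Q)
     ?s0 (14 + T)"
  proof (rule wp_fill[where m = "n - j" and p = 0 and f = "\<lambda>i. x ! (j + i)"], goal_cases)
    case (1 s')
    then show ?case using s by simp
  next
    case 2
    then show ?case by simp
  next
    case (3 s1 T1)
    then have s1: "s1 (V 0) = n" "s1 (V 4) = j" "s1 (V 5) = n - j" "s1 (V 6) = ?m"
      "\<And>i. i < n \<Longrightarrow> s1 (A v i) = x ! i" "\<And>i. i < n - j \<Longrightarrow> s1 (A 2 i) = x ! (j + i)"
      using s by simp_all
    have T1: "T1 \<le> 14 + T + 54 * (n - j + 1)" using 3(3) by simp
    show ?case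
    proof (rule wp_Seq, rule wp_fill[where m = n and p = "n - j" and f = "\<lambda>i. x ! i"], goal_cases)
      case (1 s')
      then show ?case using s s1 by simp
    next
      case 2
      then show ?case by simp
    next
      case (3 s2 T2)
      then have s2: "s2 (V 0) = n" "s2 (V 4) = j" "s2 (V 5) = n - j" "s2 (V 6) = ?m"
        "\<And>i. i < n - j \<Longrightarrow> s2 (A 2 i) = x ! (j + i)" "\<And>i. i < n \<Longrightarrow> s2 (A 2 (n - j + i)) = x ! i"
        using s1 by simp_all
      have T2: "T2 \<le> T1 + 52 * (n + 1)" using 3(3) by simp
      have z2: "s2 (A 2 i) = (drop j x @ x) ! i" if "i < ?m" for i
      proof (cases "i < n - j")
        case True
        then show ?thesis using s2(5) s by (simp add: nth_append)
      next
        case False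
        then show ?thesis using s2(6)[of "i - (n - j)"] that s by (simp add: nth_append)
      qed
      show ?case
      proof (rule wp_Seq, rule wp_zcom[where m = ?m], goal_cases)
        case 1
        then show ?case by (rule s2)
      next
        case 2
        then show ?case by simp
      next
        case (3 s3 T3)
        note r3 = 3
        have s3: "s3 (V 0) = n" "s3 (V 5) = n - j"
          using r3(3)[of "V 0"] r3(3)[of "V 5"] s2 by (simp_all add: zcom_def zcopy_def zextend_def)
        have z3: "zval ((!) (drop j x @ x)) ?m i (s3 (A 3 i))" if "1 \<le> i" "i \<le> ?m" for i
          using r3(1)[OF that] z2 unfolding zval_def by auto
        have b3: "s3 (A 3 i) \<le> 2 * n" if "i \<le> ?m" for i
          using z3[of i] that r3(2) by (cases "i = 0") (auto simp: zval_def)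
        have l3: "l \<le> s3 (A 3 (n - j + t)) \<longleftrightarrow> eqf x j t l" if "t \<le> n" "l \<le> n - j" for t l
          using zval_eqf[OF s(4,3) that] z3 that by simp
        show ?case
        proof (rule wp_fill[where m = "n + 1" and p = 0 and f = "\<lambda>t. s3 (A 3 (n - j + t))"], goal_cases)
          case (1 s')
          then show ?case using s3 s(8) by simp
        next
          case 2
          then show ?case by simp
        next
          case (3 s4 T4)
          have "s4 (A a t) = s3 (A 3 (n - j + t))" if "t \<le> n" for t
            using 3(1)[of t] that by simp
          moreover have "T4 \<le> T + 3000 * (n + 1)" using 3(3) r3(4) T2 T1 by simp
          ultimately show ?case using l3 b3 by simp
        qed
      qed
    qed
  qed
  then show "wp (lce_com v a) ?Q s T"
    unfolding lce_com_def by (intro wp_Seq wp_Assign) (use s in simp_all)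
qed (use Q in auto)

text \<open>The maximum is specified by the numbers below it, which is the shape of
  \<open>extendable_iff\<close>; the alternative \<open>p = 0\<close> is the initial value.\<close>

lemma wp_max:
  assumes s: "s (V 1) = k" "1 \<le> k" "k \<le> n" "\<And>i. i \<le> n \<Longrightarrow> s (A a i) \<le> 2 * n"
      "x \<noteq> 0" "x \<noteq> 1" "x \<noteq> 2" "x \<noteq> 9"
    and Q: "\<And>s' T'. (\<And>p. p \<le> s' (V x) \<longleftrightarrow> p = 0 \<or>
          (\<exists>d. 1 \<le> d \<and> d \<le> k \<and> p \<le> min (d - 1) (s (A a d) + d - k))) \<Longrightarrow>
      (\<And>l. \<not> modifies (max_com a x) l \<Longrightarrow> s' l = s l) \<Longrightarrow>
      T' \<le> T + 1000 * (n + 1) \<Longrightarrow> Q s' T'"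
  shows "wp (max_com a x) Q s T"
proof (rule wp_mono[where Q = "\<lambda>s' T'. (\<forall>p. p \<le> s' (V x) \<longleftrightarrow> p = 0 \<or>
          (\<exists>d. 1 \<le> d \<and> d \<le> k \<and> p \<le> min (d - 1) (s (A a d) + d - k))) \<and> T' \<le> T + 1000 * (n + 1)"])
  let ?Q = "\<lambda>s' T'. (\<forall>p. p \<le> s' (V x) \<longleftrightarrow> p = 0 \<or>
          (\<exists>d. 1 \<le> d \<and> d \<le> k \<and> p \<le> min (d - 1) (s (A a d) + d - k))) \<and> T' \<le> T + 1000 * (n + 1)"
  let ?body = "Assign 9 ((Ar a (X 2) \<oplus> X 2) \<ominus> X 1);;
        Assign x (X x \<oplus> ((X 9 \<ominus> (X 9 \<ominus> (X 2 \<ominus> N 1))) \<ominus> X x));; incr 2"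
  let ?c = "\<lambda>d. min (d - 1) (s (A a d) + d - k)"
  define I where "I = (\<lambda>s' T'. 1 \<le> s' (V 2) \<and> s' (V 2) \<le> k + 1 \<and> s' (V x) \<le> n \<and>
     (\<forall>p. p \<le> s' (V x) \<longleftrightarrow> p = 0 \<or> (\<exists>d. 1 \<le> d \<and> d < s' (V 2) \<and> p \<le> ?c d)) \<and>
     T' \<le> T + 20 + 100 * s' (V 2))"
  show "wp (max_com a x) ?Q s T"
    unfolding max_com_def
  proof (intro wp_Seq wp_Assign)
    let ?s = "s(V x := ev (N 0) s)" let ?s = "?s(V 2 := ev (N 1) ?s)"
    show "wp (While (Lt (X 2) (X 1 \<oplus> N 1)) ?body) ?Q ?s (T + (esize (N 0) + 2) + (esize (N 1) + 2))"
    proof (rule wp_While[where I = I and \<mu> = "\<lambda>s'. k + 1 - s' (V 2)"])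
      show "I ?s (T + (esize (N 0) + 2) + (esize (N 1) + 2))" using s by (auto simp: I_def)
    next
      fix s' T' assume I: "I s' T'" and fr: "\<And>l. \<not> modifies ?body l \<Longrightarrow> s' l = ?s l"
      let ?i = "s' (V 2)" and ?T = "T' + (esize (Lt (X 2) (X 1 \<oplus> N 1)) + 1)"
      have e: "s' (V 1) = k" "\<And>i. s' (A a i) = s (A a i)" using fr s by simp_all
      have i: "1 \<le> ?i" "?i \<le> k + 1" "s' (V x) \<le> n" and T': "T' \<le> T + 20 + 100 * ?i"
        and p: "\<And>p. p \<le> s' (V x) \<longleftrightarrow> p = 0 \<or> (\<exists>d. 1 \<le> d \<and> d < ?i \<and> p \<le> ?c d)"
        using I by (auto simp: I_def)
      have fin: "?Q s' ?T" if "\<not> ?i < k + 1"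
      proof -
        have "?i = k + 1" using that i by simp
        then show ?thesis using p T' s by (simp add: less_Suc_eq_le)
      qed
      have step: "wp ?body (\<lambda>s'' T''. I s'' (T'' + 1) \<and> k + 1 - s'' (V 2) < k + 1 - ?i) s' ?T"
        if c: "?i < k + 1"
      proof -
        let ?y = "s (A a ?i) + ?i - k"
        let ?E1 = "(Ar a (X 2) \<oplus> X 2) \<ominus> X 1"
        let ?E2 = "X x \<oplus> ((X 9 \<ominus> (X 9 \<ominus> (X 2 \<ominus> N 1))) \<ominus> X x)"
        define y where "y = max (s' (V x)) (?c ?i)"
        have yn: "y \<le> n" using i c s unfolding y_def by simp
        have ai: "s (A a ?i) \<le> 2 * n" using s(3,4) c by simp
        have ik: "?i \<le> k" using c by simp
        have ok1: "ok ?E1 s'" and ev1: "ev ?E1 s' = ?y" using ai ik s(3) e by simp_all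
        have ev2: "ev ?E2 (s'(V 9 := ?y)) = y" using s(5-8) unfolding y_def by simp
        have "s' (V x) + (?y - (?y - (?i - 1)) - s' (V x)) = y" unfolding y_def by simp
        with yn have ok2: "ok ?E2 (s'(V 9 := ?y))" using s(5-8)
          by (simp del: diff_diff_left)
        have "p \<le> y \<longleftrightarrow> p = 0 \<or> (\<exists>d. 1 \<le> d \<and> d < Suc ?i \<and> p \<le> ?c d)" for p
        proof -
          have "p \<le> y \<longleftrightarrow> p \<le> s' (V x) \<or> p \<le> ?c ?i" unfolding y_def by linarith
          then show ?thesis unfolding p using i(1) by (auto simp: less_Suc_eq)
        qed
        then have I': "I (s'(V 9 := ?y, V x := y, V 2 := Suc ?i)) (T' + 80)"
          using s(5-8) c T' yn unfolding I_def by simp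
        have mono: "I s1 T1 \<Longrightarrow> T2 \<le> T1 \<Longrightarrow> I s1 T2" for s1 T1 T2 by (auto simp: I_def)
        have "wp (incr 2) (\<lambda>s'' T''. I s'' (T'' + 1) \<and> k + 1 - s'' (V 2) < k + 1 - ?i)
            (s'(V 9 := ?y, V x := y)) (?T + (esize ?E1 + 2) + (esize ?E2 + 2))"
        proof (rule wp_incr)
          show "(s'(V 9 := ?y, V x := y)) (V 2) < 100 * (n + 2)" using s(3,7) ik by simp
          have "I (s'(V 9 := ?y, V x := y, V 2 := Suc ?i)) (?T + (esize ?E1 + 2) + (esize ?E2 + 2) + 6 + 1)"
            by (rule mono[OF I']) simp
          then show "I ((s'(V 9 := ?y, V x := y))(V 2 := Suc ((s'(V 9 := ?y, V x := y)) (V 2))))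
              (?T + (esize ?E1 + 2) + (esize ?E2 + 2) + 6 + 1) \<and>
              k + 1 - ((s'(V 9 := ?y, V x := y))(V 2 := Suc ((s'(V 9 := ?y, V x := y)) (V 2)))) (V 2) < k + 1 - ?i"
            using s(7) c by simp
        qed
        then have "wp (Assign x ?E2;; incr 2) (\<lambda>s'' T''. I s'' (T'' + 1) \<and> k + 1 - s'' (V 2) < k + 1 - ?i)
            (s'(V 9 := ?y)) (?T + (esize ?E1 + 2))"
          by (intro wp_Seq wp_Assign[OF ok2]) (simp only: ev2)
        then show ?thesis
          by (intro wp_Seq[of "Assign 9 ?E1"] wp_Assign[OF ok1]) (simp only: ev1)
      qed
      show "ok (Lt (X 2) (X 1 \<oplus> N 1)) s' \<and> (ev (Lt (X 2) (X 1 \<oplus> N 1)) s' = 0 \<longrightarrow> ?Q s' ?T) \<and>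
       (ev (Lt (X 2) (X 1 \<oplus> N 1)) s' \<noteq> 0 \<longrightarrow>
         wp ?body (\<lambda>s'' T''. I s'' (T'' + 1) \<and> k + 1 - s'' (V 2) < k + 1 - ?i) s' ?T)"
        using e s fin step by simp
    qed
  qed simp_all
qed (use Q in auto)

text \<open>\<open>d0\<close> is any suitable period; it only bounds the search, which stops at the
  least one.\<close>

lemma wp_period:
  assumes s: "s (V 1) = k" "k \<le> n" "\<And>i. i \<le> n \<Longrightarrow> s (A 4 i) \<le> 2 * n" "s (V 10) = pm" "pm \<le> n"
    and d0: "1 \<le> d0" "d0 \<le> k" "pm + k \<le> s (A 4 d0) + d0"
    and Q: "\<And>s' T' d. 1 \<le> d \<Longrightarrow> d \<le> k \<Longrightarrow> pm + k \<le> s (A 4 d) + d \<Longrightarrow>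
      (\<And>e. 1 \<le> e \<Longrightarrow> e < d \<Longrightarrow> s (A 4 e) + e < pm + k) \<Longrightarrow> s' (V 13) = min pm (d - 1) \<Longrightarrow>
      (\<And>l. \<not> modifies period_com l \<Longrightarrow> s' l = s l) \<Longrightarrow>
      T' \<le> T + 1000 * (n + 1) \<Longrightarrow> Q s' T'"
  shows "wp period_com Q s T"
proof (rule wp_mono[where Q = "\<lambda>s' T'. \<exists>d. 1 \<le> d \<and> d \<le> k \<and> pm + k \<le> s (A 4 d) + d \<and>
    (\<forall>e. 1 \<le> e \<longrightarrow> e < d \<longrightarrow> s (A 4 e) + e < pm + k) \<and> s' (V 13) = min pm (d - 1) \<and>
    T' \<le> T + 1000 * (n + 1)"])
  let ?Q = "\<lambda>s' T'. \<exists>d. 1 \<le> d \<and> d \<le> k \<and> pm + k \<le> s (A 4 d) + d \<and>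
    (\<forall>e. 1 \<le> e \<longrightarrow> e < d \<longrightarrow> s (A 4 e) + e < pm + k) \<and> s' (V 13) = min pm (d - 1) \<and>
    T' \<le> T + 1000 * (n + 1)"
  define I where "I = (\<lambda>s' T'. 1 \<le> s' (V 12) \<and> s' (V 12) \<le> d0 \<and>
     (\<forall>e. 1 \<le> e \<longrightarrow> e < s' (V 12) \<longrightarrow> s (A 4 e) + e < pm + k) \<and>
     T' \<le> T + 20 + 100 * s' (V 12))"
  let ?cond = "Lt (Ar 4 (X 12) \<oplus> X 12) (X 10 \<oplus> X 1)"
  show "wp period_com ?Q s T"
    unfolding period_com_def
  proof (rule wp_Seq, rule wp_Assign, simp, rule wp_Seq,
      rule wp_While[where I = I and \<mu> = "\<lambda>s'. d0 - s' (V 12)"])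
    show "I (s(V 12 := ev (N 1) s)) (T + (esize (N 1) + 2))" using d0 by (simp add: I_def)
  next
    fix s' T' assume I: "I s' T'" and fr: "\<And>l. \<not> modifies (incr 12) l \<Longrightarrow> s' l = (s(V 12 := ev (N 1) s)) l"
    let ?d = "s' (V 12)" and ?T = "T' + (esize ?cond + 1)"
    have e: "s' (V 1) = k" "s' (V 10) = pm" "\<And>i. s' (A 4 i) = s (A 4 i)" using fr s by simp_all
    have d: "1 \<le> ?d" "?d \<le> d0" and T': "T' \<le> T + 20 + 100 * ?d"
      and m: "\<And>e. 1 \<le> e \<Longrightarrow> e < ?d \<Longrightarrow> s (A 4 e) + e < pm + k"
      using I by (auto simp: I_def)
    have a: "s (A 4 ?d) \<le> 2 * n" using s d d0 by simp
    have fin: "wp (Assign 13 (X 10 \<ominus> (X 10 \<ominus> (X 12 \<ominus> N 1)))) ?Q s' ?T"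
      if "\<not> s (A 4 ?d) + ?d < pm + k"
    proof (rule wp_Assign)
      show "?Q (s'(V 13 := ev (X 10 \<ominus> (X 10 \<ominus> (X 12 \<ominus> N 1))) s'))
         (?T + (esize (X 10 \<ominus> (X 10 \<ominus> (X 12 \<ominus> N 1))) + 2))"
        using that m T' d d0 s e by (intro exI[of _ ?d]) auto
    qed simp
    have step: "wp (incr 12) (\<lambda>s'' T''. I s'' (T'' + 1) \<and> d0 - s'' (V 12) < d0 - ?d) s' ?T"
      if c: "s (A 4 ?d) + ?d < pm + k"
    proof -
      have "?d \<noteq> d0" using c d0 by auto
      then have "?d < d0" using d by simp
      then show ?thesis using d0 s c m T' d
        by (intro wp_incr) (auto simp: I_def less_Suc_eq)
    qed
    show "ok ?cond s' \<and> (ev ?cond s' = 0 \<longrightarrow> wp (Assign 13 (X 10 \<ominus> (X 10 \<ominus> (X 12 \<ominus> N 1)))) ?Q s' ?T) \<and>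
       (ev ?cond s' \<noteq> 0 \<longrightarrow>
         wp (incr 12) (\<lambda>s'' T''. I s'' (T'' + 1) \<and> d0 - s'' (V 12) < d0 - ?d) s' ?T)"
      using e s(1,2,4,5) fin step a d d0 by simp
  qed
qed (use Q in auto)

text \<open>Each round handles a \<open>p\<close> in the interval, that is, an actual occurrence at
  \<open>t\<close>. The time is therefore charged to the occurrences and not to the number of
  candidates.\<close>

lemma wp_mark_body:
  fixes u :: "'a list"
  assumes s: "s (V 0) = n" "s (V 1) = k" "1 \<le> k" "k \<le> n" "length u = n" "s (V 13) = b" "b + k \<le> n"
      "s (V 3) = t" "k \<le> t" "t \<le> n"
    and occ: "\<And>p. p \<le> b \<Longrightarrow> occ u k p t \<longleftrightarrow> k - s (A 7 (n - t)) \<le> p \<and> p \<le> s (A 6 t)"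
      "s (A 6 t) \<le> 2 * n"
    and ch: "\<And>p. p \<le> b \<Longrightarrow> chain u k t p (s (A 8 p))"
    and Q: "\<And>s' T'. (\<And>p. p \<le> b \<Longrightarrow> chain u k (Suc t) p (s' (A 8 p))) \<Longrightarrow>
      (\<And>l. \<not> modifies mark_body l \<Longrightarrow> s' l = s l) \<Longrightarrow>
      T' \<le> T + 100 + 100 * card {p. p \<le> b \<and> occ u k p t} \<Longrightarrow> Q s' T'"
  shows "wp mark_body Q s T"
proof (rule wp_mono[where Q = "\<lambda>s' T'. (\<forall>p\<le>b. chain u k (Suc t) p (s' (A 8 p))) \<and>
    T' \<le> T + 100 + 100 * card {p. p \<le> b \<and> occ u k p t}"])
  let ?Q = "\<lambda>s' T'. (\<forall>p\<le>b. chain u k (Suc t) p (s' (A 8 p))) \<and>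
    T' \<le> T + 100 + 100 * card {p. p \<le> b \<and> occ u k p t}"
  let ?cond = "And (Lt (X 2) (Ar 6 (X 3) \<oplus> N 1)) (Lt (X 2) (X 13 \<oplus> N 1))"
  let ?if = "Cond (Lt (X 1) (X 3 \<ominus> Ar 8 (X 2))) (Assign 9 (N 0)) (Upd 8 (X 2) (X 3))"
  define lo where "lo = k - s (A 7 (n - t))"
  \<comment> \<open>Candidates below \<open>lo\<close> do not occur at \<open>t\<close>, so their
    chains are valid for \<open>Suc t\<close> from the start; hence one case distinction on the
    counter suffices.\<close>
  define I where "I = (\<lambda>s' T'. lo \<le> s' (V 2) \<and>
     (\<forall>p. lo \<le> p \<longrightarrow> p < s' (V 2) \<longrightarrow> p \<le> b \<and> p \<le> s (A 6 t)) \<and>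
     (\<forall>p\<le>b. chain u k (if p < s' (V 2) then Suc t else t) p (s' (A 8 p))) \<and>
     T' \<le> T + 20 + 100 * (s' (V 2) - lo))"
  have lo: "lo \<le> k" by (simp add: lo_def)
  have not_occ: "chain u k (Suc t) p l" if "chain u k t p l" "\<not> occ u k p t" for p l
    using chain_step[OF _ s(9) that(1)] that(2) s(3) by simp
  show "wp mark_body ?Q s T"
    unfolding mark_body_def
  proof (rule wp_Seq, rule wp_Assign, use s in simp, rule wp_While[where I = I and \<mu> = "\<lambda>s'. b + 1 - s' (V 2)"])
    let ?s = "s(V 2 := ev (X 1 \<ominus> Ar 7 (X 0 \<ominus> X 3)) s)"
    have lo_ev: "?s (V 2) = lo" using s by (simp add: lo_def)
    show "I ?s (T + (esize (X 1 \<ominus> Ar 7 (X 0 \<ominus> X 3)) + 2))"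
      using ch occ(1) not_occ unfolding I_def lo_ev by (auto simp: lo_def)
    fix s' T' assume I: "I s' T'" and fr: "\<And>l. \<not> modifies (?if;; incr 2) l \<Longrightarrow> s' l = ?s l"
    let ?p = "s' (V 2)" and ?T = "T' + (esize ?cond + 1)"
    have e: "s' (V 1) = k" "s' (V 3) = t" "s' (V 13) = b" "s' (A 6 t) = s (A 6 t)"
      using fr s by simp_all
    have p: "lo \<le> ?p" "\<And>p. lo \<le> p \<Longrightarrow> p < ?p \<Longrightarrow> p \<le> b \<and> p \<le> s (A 6 t)"
      and ch': "\<And>p. p \<le> b \<Longrightarrow> chain u k (if p < ?p then Suc t else t) p (s' (A 8 p))"
      and T': "T' \<le> T + 20 + 100 * (?p - lo)" using I by (auto simp: I_def)
    have fin: "?Q s' ?T" if c: "\<not> (?p < s (A 6 t) + 1 \<and> ?p < b + 1)"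
    proof
      show "\<forall>p\<le>b. chain u k (Suc t) p (s' (A 8 p))"
      proof (intro allI impI)
        fix p assume "p \<le> b"
        then show "chain u k (Suc t) p (s' (A 8 p))"
          using ch'[of p] occ(1)[of p] not_occ c by (cases "p < ?p") auto
      qed
      have "{lo..<?p} \<subseteq> {p. p \<le> b \<and> occ u k p t}"
        using p(2) occ(1) by (auto simp: lo_def)
      then have "?p - lo \<le> card {p. p \<le> b \<and> occ u k p t}"
        using card_mono[of "{p. p \<le> b \<and> occ u k p t}" "{lo..<?p}"] by simp
      then show "?T \<le> T + 100 + 100 * card {p. p \<le> b \<and> occ u k p t}" using T' by simp
    qed
    have step: "wp (?if;; incr 2) (\<lambda>s'' T''. I s'' (T'' + 1) \<and> b + 1 - s'' (V 2) < b + 1 - ?p) s' ?T"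
      if c: "?p < s (A 6 t) + 1 \<and> ?p < b + 1"
    proof -
      have pb: "?p \<le> b" "?p \<le> s (A 6 t)" using c by auto
      then have o: "occ u k ?p t" using occ(1) p(1) by (simp add: lo_def)
      let ?l = "s' (A 8 ?p)"
      have cs: "chain u k (Suc t) ?p (if t \<le> ?l + k then t else ?l)"
        using chain_step[OF _ s(9), of u ?p ?l] ch'[OF pb(1)] s(3) o by simp
      have next_p: "wp (incr 2) (\<lambda>s'' T''. I s'' (T'' + 1) \<and> b + 1 - s'' (V 2) < b + 1 - ?p) s1 T1"
        if s1: "s1 (V 2) = ?p" "\<And>q. q \<noteq> ?p \<Longrightarrow> s1 (A 8 q) = s' (A 8 q)"
           "s1 (A 8 ?p) = (if t \<le> ?l + k then t else ?l)" "T1 \<le> T' + 80" for s1 T1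
      proof (rule wp_incr)
        show "s1 (V 2) < 100 * (n + 2)" using s1 pb s(7) by simp
        have "I (s1(V 2 := Suc (s1 (V 2)))) (T1 + 6 + 1)"
          unfolding I_def
        proof (intro conjI allI impI)
          fix q assume "q \<le> b"
          then show "chain u k (if q < (s1(V 2 := Suc (s1 (V 2)))) (V 2) then Suc t else t) q
              ((s1(V 2 := Suc (s1 (V 2)))) (A 8 q))"
            using ch'[of q] cs s1 by (cases "q = ?p") (simp_all add: less_Suc_eq)
        next
          have "Suc ?p - lo = Suc (?p - lo)" using p(1) by simp
          then show "T1 + 6 + 1 \<le> T + 20 + 100 * ((s1(V 2 := Suc (s1 (V 2)))) (V 2) - lo)"
            using T' s1(1,4) by simp
        qed (use p s1(1) pb in \<open>auto simp: less_Suc_eq\<close>)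
        then show "I (s1(V 2 := Suc (s1 (V 2)))) (T1 + 6 + 1) \<and>
            b + 1 - (s1(V 2 := Suc (s1 (V 2)))) (V 2) < b + 1 - ?p" using s1(1) pb by simp
      qed
      have pn: "?p \<le> n" using pb s(7) by simp
      show ?thesis
      proof (rule wp_Seq, rule wp_Cond)
        show "ok (Lt (X 1) (X 3 \<ominus> Ar 8 (X 2))) s'" using pn by simp
      next
        assume "ev (Lt (X 1) (X 3 \<ominus> Ar 8 (X 2))) s' \<noteq> 0"
        then have "\<not> t \<le> ?l + k" using e by (simp split: if_splits)
        then show "wp (Assign 9 (N 0)) (\<lambda>s'' T''. wp (incr 2) (\<lambda>s'' T''. I s'' (T'' + 1) \<and>
            b + 1 - s'' (V 2) < b + 1 - ?p) s'' (T'' + 1)) s' (?T + (esize (Lt (X 1) (X 3 \<ominus> Ar 8 (X 2))) + 1))"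
          by (intro wp_Assign next_p) simp_all
      next
        assume "ev (Lt (X 1) (X 3 \<ominus> Ar 8 (X 2))) s' = 0"
        then have "t \<le> ?l + k" using e by (simp split: if_splits)
        then show "wp (Upd 8 (X 2) (X 3)) (wp (incr 2) (\<lambda>s'' T''. I s'' (T'' + 1) \<and>
            b + 1 - s'' (V 2) < b + 1 - ?p)) s' (?T + (esize (Lt (X 1) (X 3 \<ominus> Ar 8 (X 2))) + 1))"
          using pn e by (intro wp_Upd next_p) simp_all
      qed
    qed
    show "ok ?cond s' \<and> (ev ?cond s' = 0 \<longrightarrow> ?Q s' ?T) \<and>
       (ev ?cond s' \<noteq> 0 \<longrightarrow>
         wp (?if;; incr 2) (\<lambda>s'' T''. I s'' (T'' + 1) \<and> b + 1 - s'' (V 2) < b + 1 - ?p) s' ?T)"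
    proof -
      have okc: "ok ?cond s'" using e s(4,7,10) occ(2) by simp
      have evc: "ev ?cond s' = of_bool (?p < s (A 6 t) + 1 \<and> ?p < b + 1)" using e by simp
      show ?thesis using okc evc fin step by (simp only: of_bool_eq_0_iff) blast
    qed
  qed
qed (use Q in auto)

text \<open>The budget is a constant for each \<open>t\<close> plus a constant for each occurrence,
  and \<open>card\<close> bounds the latter in total.\<close>

lemma wp_mark:
  fixes u :: "'a list"
  assumes s: "s (V 0) = n" "s (V 1) = k" "1 \<le> k" "k \<le> n" "length u = n" "s (V 13) = b" "b + k \<le> n"
    and occ: "\<And>t p. k \<le> t \<Longrightarrow> t \<le> n \<Longrightarrow> p \<le> b \<Longrightarrow>
        occ u k p t \<longleftrightarrow> k - s (A 7 (n - t)) \<le> p \<and> p \<le> s (A 6 t)"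
      "\<And>t. t \<le> n \<Longrightarrow> s (A 6 t) \<le> 2 * n"
    and ch: "\<And>p. p \<le> b \<Longrightarrow> s (A 8 p) = k"
    and card: "\<And>j. (\<Sum>t\<in>{k..<j}. card {p. p \<le> b \<and> occ u k p t}) \<le> n"
    and Q: "\<And>s' T'. (\<And>p. p \<le> b \<Longrightarrow> chain u k (Suc n) p (s' (A 8 p))) \<Longrightarrow>
      (\<And>l. \<not> modifies mark_com l \<Longrightarrow> s' l = s l) \<Longrightarrow>
      T' \<le> T + 1000 * (n + 1) \<Longrightarrow> Q s' T'"
  shows "wp mark_com Q s T"
proof (rule wp_mono[where Q = "\<lambda>s' T'. (\<forall>p\<le>b. chain u k (Suc n) p (s' (A 8 p))) \<and>
    T' \<le> T + 1000 * (n + 1)"])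
  let ?Q = "\<lambda>s' T'. (\<forall>p\<le>b. chain u k (Suc n) p (s' (A 8 p))) \<and> T' \<le> T + 1000 * (n + 1)"
  let ?S = "\<lambda>j. \<Sum>t\<in>{k..<j}. card {p. p \<le> b \<and> occ u k p t}"
  define I where "I = (\<lambda>s' T'. k \<le> s' (V 3) \<and> s' (V 3) \<le> n + 1 \<and>
     (\<forall>p\<le>b. chain u k (s' (V 3)) p (s' (A 8 p))) \<and>
     T' \<le> T + 20 + 200 * s' (V 3) + 100 * ?S (s' (V 3)))"
  show "wp mark_com ?Q s T"
    unfolding mark_com_def
  proof (rule wp_Seq, rule wp_Assign, simp, rule wp_While[where I = I and \<mu> = "\<lambda>s'. n + 1 - s' (V 3)"])
    let ?s = "s(V 3 := ev (X 1) s)"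
    show "I ?s (T + (esize (X 1) + 2))"
      using s ch by (auto simp: I_def intro!: chain_init)
    fix s' T' assume I: "I s' T'" and fr: "\<And>l. \<not> modifies (mark_body;; incr 3) l \<Longrightarrow> s' l = ?s l"
    let ?t = "s' (V 3)" and ?T = "T' + (esize (Lt (X 3) (X 0 \<oplus> N 1)) + 1)"
    have e: "s' (V 0) = n" "s' (V 1) = k" "s' (V 13) = b" "\<And>i. s' (A 6 i) = s (A 6 i)"
      "\<And>i. s' (A 7 i) = s (A 7 i)"
      using fr s by (simp_all add: mark_body_def)
    have t: "k \<le> ?t" "?t \<le> n + 1" and ch': "\<And>p. p \<le> b \<Longrightarrow> chain u k ?t p (s' (A 8 p))"
      and T': "T' \<le> T + 20 + 200 * ?t + 100 * ?S ?t" using I by (auto simp: I_def)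
    have fin: "?Q s' ?T" if c: "\<not> ?t < n + 1"
    proof -
      have "?t = Suc n" using c t by simp
      then show ?thesis using ch' T' card[of "Suc n"] by simp
    qed
    have step: "wp (mark_body;; incr 3) (\<lambda>s'' T''. I s'' (T'' + 1) \<and> n + 1 - s'' (V 3) < n + 1 - ?t) s' ?T"
      if c: "?t < n + 1"
    proof (rule wp_Seq, rule wp_mark_body[OF e(1,2) s(3,4,5) e(3) s(7)])
      fix s1 T1
      assume s1: "\<And>p. p \<le> b \<Longrightarrow> chain u k (Suc ?t) p (s1 (A 8 p))"
        "\<And>l. \<not> modifies mark_body l \<Longrightarrow> s1 l = s' l"
        "T1 \<le> ?T + 100 + 100 * card {p. p \<le> b \<and> occ u k p ?t}"
      have v3: "s1 (V 3) = ?t" using s1(2) by (simp add: mark_body_def)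
      show "wp (incr 3) (\<lambda>s'' T''. I s'' (T'' + 1) \<and> n + 1 - s'' (V 3) < n + 1 - ?t) s1 T1"
      proof (rule wp_incr)
        show "s1 (V 3) < 100 * (n + 2)" using v3 t by simp
        have "?S (Suc ?t) = ?S ?t + card {p. p \<le> b \<and> occ u k p ?t}" using t(1) by simp
        then have "I (s1(V 3 := Suc (s1 (V 3)))) (T1 + 6 + 1)"
          using s1(1,3) c t T' unfolding I_def v3 by simp
        then show "I (s1(V 3 := Suc (s1 (V 3)))) (T1 + 6 + 1) \<and>
            n + 1 - (s1(V 3 := Suc (s1 (V 3)))) (V 3) < n + 1 - ?t" using v3 c by simp
      qed
    qed (use t c e occ ch' in auto)
    show "ok (Lt (X 3) (X 0 \<oplus> N 1)) s' \<and> (ev (Lt (X 3) (X 0 \<oplus> N 1)) s' = 0 \<longrightarrow> ?Q s' ?T) \<and>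
       (ev (Lt (X 3) (X 0 \<oplus> N 1)) s' \<noteq> 0 \<longrightarrow>
         wp (mark_body;; incr 3) (\<lambda>s'' T''. I s'' (T'' + 1) \<and> n + 1 - s'' (V 3) < n + 1 - ?t) s' ?T)"
      using e(1) fin step by simp
  qed
qed (use Q in auto)

lemma wp_answer:
  assumes s: "s (V 0) = n" "s (V 13) = b" "b \<le> n" "s (V 11) = r" "r \<le> n"
      "\<And>p. p \<le> b \<Longrightarrow> s (A 8 p) \<le> n"
    and Q: "\<And>s' T'. s' (V 0) = of_bool (\<exists>p\<le>b. n \<le> s (A 8 p) + p + r) \<Longrightarrow>
      T' \<le> T + 1000 * (n + 1) \<Longrightarrow> Q s' T'"
  shows "wp answer_com Q s T"
proof -
  let ?P = "\<lambda>p. n \<le> s (A 8 p) + p + r"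
  let ?c = "Lt ((Ar 8 (X 2) \<oplus> X 2) \<oplus> X 11) (X 0)"
  let ?if = "Cond ?c (Assign 9 (N 0)) (Assign 14 (N 1))"
  define I where "I = (\<lambda>s' T'. s' (V 2) \<le> b + 1 \<and> s' (V 14) = of_bool (\<exists>p < s' (V 2). ?P p) \<and>
     T' \<le> T + 20 + 100 * s' (V 2))"
  show ?thesis
    unfolding answer_com_def
  proof (rule wp_Seq, rule wp_Assign, simp, rule wp_Seq, rule wp_Assign, simp, rule wp_Seq,
      rule wp_While[where I = I and \<mu> = "\<lambda>s'. b + 1 - s' (V 2)"])
    let ?s = "s(V 14 := ev (N 0) s)" let ?s = "?s(V 2 := ev (N 0) ?s)"
    show "I ?s (T + (esize (N 0) + 2) + (esize (N 0) + 2))" by (simp add: I_def)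
    fix s' T' assume I: "I s' T'" and fr: "\<And>l. \<not> modifies (?if;; incr 2) l \<Longrightarrow> s' l = ?s l"
    let ?p = "s' (V 2)" and ?T = "T' + (esize (Lt (X 2) (X 13 \<oplus> N 1)) + 1)"
    have e: "s' (V 0) = n" "s' (V 13) = b" "s' (V 11) = r" "\<And>i. s' (A 8 i) = s (A 8 i)"
      using fr s by simp_all
    have p: "?p \<le> b + 1" "s' (V 14) = of_bool (\<exists>p < ?p. ?P p)" and T': "T' \<le> T + 20 + 100 * ?p"
      using I by (auto simp: I_def)
    have fin: "wp (Assign 0 (X 14)) Q s' ?T" if c: "\<not> ?p < b + 1"
    proof (rule wp_Assign)
      have "?p = Suc b" using c p by simp
      then show "Q (s'(V 0 := ev (X 14) s')) (?T + (esize (X 14) + 2))"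
        using p(2) T' s(3) by (intro Q) (simp_all add: less_Suc_eq_le)
    qed simp
    have step: "wp (?if;; incr 2) (\<lambda>s'' T''. I s'' (T'' + 1) \<and> b + 1 - s'' (V 2) < b + 1 - ?p) s' ?T"
      if c: "?p < b + 1"
    proof -
      have pb: "?p \<le> b" using c by simp
      have ap: "s (A 8 ?p) \<le> n" using s(6) pb by simp
      have next_p: "wp (incr 2) (\<lambda>s'' T''. I s'' (T'' + 1) \<and> b + 1 - s'' (V 2) < b + 1 - ?p) s1 T1"
        if s1: "s1 (V 2) = ?p" "s1 (V 14) = of_bool (\<exists>p < Suc ?p. ?P p)" "T1 \<le> T' + 80" for s1 T1
        using s1 pb s(3) T' by (intro wp_incr) (simp_all add: I_def)
      show ?thesis
      proof (rule wp_Seq, rule wp_Cond)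
        show "ok ?c s'" using pb ap s(3,5) e by simp
      next
        assume "ev ?c s' \<noteq> 0"
        then have "\<not> ?P ?p" using e by (simp split: if_splits)
        then show "wp (Assign 9 (N 0)) (\<lambda>s'' T''. wp (incr 2) (\<lambda>s'' T''. I s'' (T'' + 1) \<and>
            b + 1 - s'' (V 2) < b + 1 - ?p) s'' (T'' + 1)) s' (?T + (esize ?c + 1))"
          using p(2) by (intro wp_Assign next_p) (auto simp: less_Suc_eq)
      next
        assume "ev ?c s' = 0"
        then have "?P ?p" using e by (simp split: if_splits)
        then show "wp (Assign 14 (N 1)) (wp (incr 2) (\<lambda>s'' T''. I s'' (T'' + 1) \<and>
            b + 1 - s'' (V 2) < b + 1 - ?p)) s' (?T + (esize ?c + 1))"
          by (intro wp_Assign next_p) (auto simp: less_Suc_eq)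
      qed
    qed
    show "ok (Lt (X 2) (X 13 \<oplus> N 1)) s' \<and>
       (ev (Lt (X 2) (X 13 \<oplus> N 1)) s' = 0 \<longrightarrow> wp (Assign 0 (X 14)) Q s' ?T) \<and>
       (ev (Lt (X 2) (X 13 \<oplus> N 1)) s' \<noteq> 0 \<longrightarrow>
         wp (?if;; incr 2) (\<lambda>s'' T''. I s'' (T'' + 1) \<and> b + 1 - s'' (V 2) < b + 1 - ?p) s' ?T)"
      using e(2) fin step s(3) by simp
  qed
qed

end

section \<open>The complete program and the packing of its input\<close>

definition seed_com :: com where
  "seed_com = fill 1 (N 0) (X 0) (Ar 0 ((X 0 \<ominus> N 1) \<ominus> X 2));;
     Assign 4 (N 0);; lce_com 0 4;; lce_com 1 5;;
     Assign 4 (X 1);; lce_com 0 6;; Assign 4 (X 0 \<ominus> X 1);; lce_com 1 7;;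
     max_com 4 10;; max_com 5 11;; period_com;;
     fill 8 (N 0) (X 13 \<oplus> N 1) (X 1);; mark_com;; answer_com"

definition main_com :: com where
  "main_com = Cond (Lt (X 0) (X 1)) (Assign 0 (N 0)) (Cond (X 1) seed_com (Assign 0 (Eq (X 0) (N 0))))"

definition packed :: nat where "packed = hdr - 2"

text \<open>The last letter packed is the lowest digit, so the first loop counts down, and what
  finally remains is \<open>n\<close>. For short words the surplus digits are zeros stored behind
  the word. The second loop copies the letters still in place.\<close>

definition unpack_com :: "nat \<Rightarrow> com" where
  "unpack_com q = Assign 2 (N packed);;
     While (X 2)
       (Assign 2 (X 2 \<ominus> N 1);; Assign 9 (Bop Over (X 0) (N q));;
        Upd 0 (X 2) (X 0 \<ominus> Bop Times (X 9) (N q));; Assign 0 (X 9));;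
     Assign 2 (N packed);;
     While (Lt (X 2) (X 0)) (Upd 0 (X 2) (In (X 2));; incr 2)"

text \<open>A numeral in base \<open>q\<close> whose leading digit is \<open>n\<close>. It may
  exceed \<open>q\<close>, and being in front it can be recovered by one division.\<close>

primrec pack :: "nat \<Rightarrow> (nat \<Rightarrow> nat) \<Rightarrow> nat \<Rightarrow> nat \<Rightarrow> nat" where
  "pack q x n 0 = n"
| "pack q x n (Suc i) = pack q x n i * q + x i"

lemma pack_less: "(\<And>i. x i < q) \<Longrightarrow> pack q x n i < (n + 1) * q ^ i"
proof (induction i)
  case (Suc i)
  have "pack q x n (Suc i) < (pack q x n i + 1) * q" using Suc.prems by simp
  also have "\<dots> \<le> ((n + 1) * q ^ i) * q" using Suc by (intro mult_le_mono1) (simp add: Suc_leI)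
  finally show ?case by (simp add: ac_simps)
qed simp

lemma pack_div: "(\<And>i. x i < q) \<Longrightarrow> pack q x n i div q ^ i = n"
proof (induction i)
  case (Suc i)
  have "q > 0" using Suc.prems[of 0] by simp
  then have "pack q x n (Suc i) div q = pack q x n i" using Suc.prems[of i] by simp
  then show ?case using Suc by (simp add: div_mult2_eq)
qed simp

lemma pack_mono:
  assumes "0 < q" "i \<le> j"
  shows "pack q x n i \<le> pack q x n j"
  using assms(2)
proof (induction rule: dec_induct)
  case (step m)
  have "pack q x n m \<le> pack q x n m * q" using assms(1) by simp
  with step.IH have "pack q x n i \<le> pack q x n m * q" by (rule order_trans)
  then show ?case by simp
qed simp

lemma modifies_lce [simp]:
  "modifies (lce_com v a) l \<longleftrightarrow> l \<in> {V 2, V 5, V 6, V 7, V 8, V 9} \<or> (\<exists>i. l = A 2 i \<or> l = A 3 i \<or> l = A a i)"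
  by (auto simp: lce_com_def zcom_def zcopy_def zextend_def)

lemma modifies_max [simp]: "modifies (max_com a x) l \<longleftrightarrow> l \<in> {V 2, V 9, V x}"
  by (auto simp: max_com_def)

lemma modifies_period [simp]: "modifies period_com l \<longleftrightarrow> l \<in> {V 12, V 13}"
  by (auto simp: period_com_def)

lemma modifies_mark [simp]: "modifies mark_com l \<longleftrightarrow> l \<in> {V 2, V 3, V 9} \<or> (\<exists>i. l = A 8 i)"
  by (auto simp: mark_com_def mark_body_def)

context seed_ram
begin

lemma wp_seed_tail:
  fixes u :: "nat list"
  assumes k: "1 \<le> k" "k \<le> n" and u: "length u = n"
    and s: "s (V 0) = n" "s (V 1) = k"
      "\<And>t l. t \<le> n \<Longrightarrow> l \<le> n \<Longrightarrow> l \<le> s (A 4 t) \<longleftrightarrow> eqf u 0 t l"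
      "\<And>t. t \<le> n \<Longrightarrow> s (A 4 t) \<le> 2 * n"
      "\<And>t l. t \<le> n \<Longrightarrow> l \<le> n \<Longrightarrow> l \<le> s (A 5 t) \<longleftrightarrow> eqf (rev u) 0 t l"
      "\<And>t. t \<le> n \<Longrightarrow> s (A 5 t) \<le> 2 * n"
      "\<And>t l. t \<le> n \<Longrightarrow> l \<le> n - k \<Longrightarrow> l \<le> s (A 6 t) \<longleftrightarrow> eqf u k t l"
      "\<And>t. t \<le> n \<Longrightarrow> s (A 6 t) \<le> 2 * n"
      "\<And>t l. t \<le> n \<Longrightarrow> l \<le> k \<Longrightarrow> l \<le> s (A 7 t) \<longleftrightarrow> eqf (rev u) (n - k) t l"
    and T: "T \<le> T0 + 13000 * (n + 1)"
    and Q: "\<And>s' T'. s' (V 0) = of_bool (has_seed_of_length u k) \<Longrightarrow>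
      T' \<le> T0 + 30000 * (n + 1) \<Longrightarrow> Q s' T'"
  shows "wp (max_com 4 10;; max_com 5 11;; period_com;;
     fill 8 (N 0) (X 13 \<oplus> N 1) (X 1);; mark_com;; answer_com) Q s T"
proof (rule wp_Seq, rule wp_max[where k = k], goal_cases)
  case (9 s1 T1)
  note r1 = 9
  define pm where "pm = s1 (V 10)"
  have ext0: "extendable v k 0" if "length v = n" for v :: "nat list"
    using k that unfolding extendable_def eqf_def by (intro exI[of _ k]) simp
  have pm: "p \<le> pm \<longleftrightarrow> extendable u k p" for p
    using r1(1)[of p] extendable_iff[of k u "\<lambda>d. s (A 4 d)" p] k u s(3) ext0[OF u]
    unfolding pm_def by (cases "p = 0") auto
  have s1: "s1 (V 0) = n" "s1 (V 1) = k" "\<And>i j. s1 (A j i) = s (A j i)"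
    using r1(2) s by simp_all
  have "extendable u k pm" using pm by blast
  \<comment> \<open>\<open>pm\<close> itself is extendable, and its period guarantees that the
    search for the least one ends within \<open>k\<close>.\<close>
  then obtain d0 where d0: "pm < d0" "d0 \<le> k" "eqf u 0 d0 (pm + k - d0)"
    unfolding extendable_def by blast
  have pmn: "pm + k \<le> n" using d0 u by (auto simp: eqf_def)
  have per: "pm + k \<le> s (A 4 e) + e \<longleftrightarrow> eqf u 0 e (pm + k - e)" if "e \<le> k" for e
  proof -
    have "pm + k - e \<le> n" "e \<le> n" using that k pmn by linarith+
    then have "pm + k - e \<le> s (A 4 e) \<longleftrightarrow> eqf u 0 e (pm + k - e)" using s(3) by blast
    then show ?thesis by (simp add: le_diff_conv)
  qed
  have d0A: "pm + k \<le> s (A 4 d0) + d0" using per[of d0] d0 by simp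
  show ?case
  proof (rule wp_Seq, rule wp_max[where k = k], goal_cases)
    case (9 s2 T2)
    note r2 = 9
    define rm where "rm = s2 (V 11)"
    have rm: "p \<le> rm \<longleftrightarrow> extendable (rev u) k p" for p
      using r2(1)[of p] extendable_iff[of k "rev u" "\<lambda>d. s (A 5 d)" p] k u s(5) s1 ext0[of "rev u"]
      unfolding rm_def by (cases "p = 0") auto
    have s2: "s2 (V 0) = n" "s2 (V 1) = k" "s2 (V 10) = pm" "\<And>i j. s2 (A j i) = s (A j i)"
      using r2(2) s1 by (simp_all add: pm_def)
    have rn: "rm \<le> n" using rm[of rm] k by (auto simp: extendable_def)
    show ?case
    proof (rule wp_Seq, rule wp_period[where k = k and pm = pm and ?d0.0 = d0], goal_cases)
      case (9 s3 T3 d)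
      note r3 = 9
      define b where "b = min pm (d - 1)"
      have s3: "s3 (V 0) = n" "s3 (V 1) = k" "s3 (V 11) = rm" "s3 (V 13) = b"
        "\<And>i j. s3 (A j i) = s (A j i)"
        using r3(5,6) s2 by (simp_all add: rm_def b_def)
      have d: "1 \<le> d" "d \<le> k" "eqf u 0 d (pm + k - d)"
        using r3(1-3) s2(4) per[of d] by simp_all
      have min: "\<not> eqf u 0 e (pm + k - e)" if "0 < e" "e < d" for e
        using r3(4)[of e] s2(4) per[of e] that d by auto
      have b: "b < d" "b \<le> pm" "b + k \<le> n" using d pmn by (auto simp: b_def)
      show ?case
      proof (rule wp_Seq, rule wp_fill[where m = "b + 1" and p = 0 and f = "\<lambda>_. k"], goal_cases)
        case (1 s')
        then show ?case using s3 b by simp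
      next
        case 2
        then show ?case using b by simp
      next
        case (3 s4 T4)
        then have s4: "s4 (V 0) = n" "s4 (V 1) = k" "s4 (V 11) = rm" "s4 (V 13) = b"
          "\<And>i. s4 (A 6 i) = s (A 6 i)" "\<And>i. s4 (A 7 i) = s (A 7 i)" "\<And>p. p \<le> b \<Longrightarrow> s4 (A 8 p) = k"
          using s3 by simp_all
        have T4: "T4 \<le> T3 + 100 * (n + 1)" using 3(3) b by simp
        show ?case
        proof (rule wp_Seq, rule wp_mark[OF s4(1,2) k u s4(4) b(3)], goal_cases)
          case (1 t p)
          have "p \<le> k" "p \<le> n - k" using 1 b d by auto
          then have "occ u k p t \<longleftrightarrow> p \<le> s (A 6 t) \<and> k - p \<le> s (A 7 (n - t))"
            using occ_iff[of p k t u] 1 u s(7)[of t p] s(9)[of "n - t" "k - p"] by simp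
          then show ?case unfolding s4 by auto
        next
          case (2 t)
          then show ?case using s(8) s4 by simp
        next
          case 3
          then show ?case using s4 by simp
        next
          case (4 j)
          show ?case
            using sum_card_occ_le[of k "pm + k" u b d j] k u pmn b d min by simp
        next
          case (5 s5 T5)
          have s5: "s5 (V 0) = n" "s5 (V 11) = rm" "s5 (V 13) = b" using 5(2) s4 by simp_all
          have ch: "chain u k (Suc n) p (s5 (A 8 p))" if "p \<le> b" for p
            using 5(1) that .
          have bd: "s5 (A 8 p) \<le> n" if "p \<le> b" for p
            using ch[OF that] u by (auto simp: chain_def occ_def eqf_def)
          show ?case
          proof (rule wp_answer[OF s5(1,3) _ s5(2) rn bd], use b in simp, simp, rule Q)
            fix s' T'
            assume v: "s' (V 0) = of_bool (\<exists>p\<le>b. n \<le> s5 (A 8 p) + p + rm)"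
              and T': "T' \<le> T5 + 1000 * (n + 1)"
            have "has_seed_of_length u k \<longleftrightarrow> (\<exists>p\<le>b. n \<le> s5 (A 8 p) + p + rm)"
              using has_seed_of_length_iff[of k u pm rm d "\<lambda>p. s5 (A 8 p)"] k u pm rm d ch
              unfolding b_def by simp
            then show "s' (V 0) = of_bool (has_seed_of_length u k)" using v by simp
            show "T' \<le> T0 + 30000 * (n + 1)"
              using T' 5(3) T4 r3(7) r2(3) r1(3) T by simp
          qed
        qed
      qed
    qed (use s2 s k d0 d0A pmn in simp_all)
  qed (use s1 s(4,6) k in simp_all)
qed (use s(2,4) k in simp_all)

lemma wp_seed:
  fixes u :: "nat list"
  assumes s: "s (V 0) = n" "s (V 1) = k" and k: "1 \<le> k" "k \<le> n" and u: "length u = n"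
      "\<And>i. i < n \<Longrightarrow> s (A 0 i) = u ! i"
    and Q: "\<And>s' T'. s' (V 0) = of_bool (has_seed_of_length u k) \<Longrightarrow>
      T' \<le> T + 30000 * (n + 1) \<Longrightarrow> Q s' T'"
  shows "wp seed_com Q s T"
  unfolding seed_com_def
proof (rule wp_Seq, rule wp_fill[where m = n and p = 0 and f = "\<lambda>i. rev u ! i"], goal_cases)
  case (1 s')
  then show ?case using s u by (auto simp: rev_nth)
next
  case 2
  show ?case by simp
next
  case (3 s1 T1)
  then have s1: "s1 (V 0) = n" "s1 (V 1) = k" "\<And>i. i < n \<Longrightarrow> s1 (A 0 i) = u ! i"
    "\<And>i. i < n \<Longrightarrow> s1 (A 1 i) = rev u ! i"
    using s u by simp_all
  have T1: "T1 \<le> T + 100 * (n + 1)" using 3(3) by simp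
  have lr: "length (rev u) = n" using u by simp
  show ?case
  proof (rule wp_Seq, rule wp_Assign, simp, rule wp_Seq, rule wp_lce[where j = 0 and x = u], goal_cases)
    case (9 s2 T2)
    then have s2: "s2 (V 0) = n" "s2 (V 1) = k" "\<And>i. i < n \<Longrightarrow> s2 (A 0 i) = u ! i"
      "\<And>i. i < n \<Longrightarrow> s2 (A 1 i) = rev u ! i" "s2 (V 4) = 0"
      "\<And>t l. t \<le> n \<Longrightarrow> l \<le> n \<Longrightarrow> l \<le> s2 (A 4 t) \<longleftrightarrow> eqf u 0 t l"
      "\<And>t. t \<le> n \<Longrightarrow> s2 (A 4 t) \<le> 2 * n"
      using s1 by simp_all
    have T2: "T2 \<le> T1 + 3 + 3000 * (n + 1)" using 9(4) by simp
    show ?case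
    proof (rule wp_Seq, rule wp_lce[where j = 0 and x = "rev u"], goal_cases)
      case (9 s3 T3)
      then have s3: "s3 (V 0) = n" "s3 (V 1) = k" "\<And>i. i < n \<Longrightarrow> s3 (A 0 i) = u ! i"
        "\<And>i. i < n \<Longrightarrow> s3 (A 1 i) = rev u ! i"
        "\<And>t l. t \<le> n \<Longrightarrow> l \<le> n \<Longrightarrow> l \<le> s3 (A 4 t) \<longleftrightarrow> eqf u 0 t l"
        "\<And>t. t \<le> n \<Longrightarrow> s3 (A 4 t) \<le> 2 * n"
        "\<And>t l. t \<le> n \<Longrightarrow> l \<le> n \<Longrightarrow> l \<le> s3 (A 5 t) \<longleftrightarrow> eqf (rev u) 0 t l"
        "\<And>t. t \<le> n \<Longrightarrow> s3 (A 5 t) \<le> 2 * n"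
        using s2 by simp_all
      have T3: "T3 \<le> T2 + 3000 * (n + 1)" using 9(4) .
      show ?case
      proof (rule wp_Seq, rule wp_Assign, simp, rule wp_Seq, rule wp_lce[where j = k and x = u], goal_cases)
        case (9 s4 T4)
        then have s4: "s4 (V 0) = n" "s4 (V 1) = k"
          "\<And>i. i < n \<Longrightarrow> s4 (A 1 i) = rev u ! i"
          "\<And>t l. t \<le> n \<Longrightarrow> l \<le> n \<Longrightarrow> l \<le> s4 (A 4 t) \<longleftrightarrow> eqf u 0 t l"
          "\<And>t. t \<le> n \<Longrightarrow> s4 (A 4 t) \<le> 2 * n"
          "\<And>t l. t \<le> n \<Longrightarrow> l \<le> n \<Longrightarrow> l \<le> s4 (A 5 t) \<longleftrightarrow> eqf (rev u) 0 t l"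
          "\<And>t. t \<le> n \<Longrightarrow> s4 (A 5 t) \<le> 2 * n"
          "\<And>t l. t \<le> n \<Longrightarrow> l \<le> n - k \<Longrightarrow> l \<le> s4 (A 6 t) \<longleftrightarrow> eqf u k t l"
          "\<And>t. t \<le> n \<Longrightarrow> s4 (A 6 t) \<le> 2 * n"
          using s3 by simp_all
        have T4: "T4 \<le> T3 + 4 + 3000 * (n + 1)" using 9(4) by simp
        show ?case
        proof (rule wp_Seq, rule wp_Assign, simp, rule wp_Seq,
            rule wp_lce[where j = "n - k" and x = "rev u"], goal_cases)
          case (9 s5 T5)
          then have s5: "s5 (V 0) = n" "s5 (V 1) = k"
            "\<And>t l. t \<le> n \<Longrightarrow> l \<le> n \<Longrightarrow> l \<le> s5 (A 4 t) \<longleftrightarrow> eqf u 0 t l"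
            "\<And>t. t \<le> n \<Longrightarrow> s5 (A 4 t) \<le> 2 * n"
            "\<And>t l. t \<le> n \<Longrightarrow> l \<le> n \<Longrightarrow> l \<le> s5 (A 5 t) \<longleftrightarrow> eqf (rev u) 0 t l"
            "\<And>t. t \<le> n \<Longrightarrow> s5 (A 5 t) \<le> 2 * n"
            "\<And>t l. t \<le> n \<Longrightarrow> l \<le> n - k \<Longrightarrow> l \<le> s5 (A 6 t) \<longleftrightarrow> eqf u k t l"
            "\<And>t. t \<le> n \<Longrightarrow> s5 (A 6 t) \<le> 2 * n"
            "\<And>t l. t \<le> n \<Longrightarrow> l \<le> k \<Longrightarrow> l \<le> s5 (A 7 t) \<longleftrightarrow> eqf (rev u) (n - k) t l"
            using s4 k by simp_all
          have T5: "T5 \<le> T + 13000 * (n + 1)" using 9(4) T4 T3 T2 T1 by simp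
          show ?case by (rule wp_seed_tail[OF k u(1) s5 T5 Q])
        qed (use s4 u k in simp_all)
      qed (use s3 u k in simp_all)
    qed (use s2 u in simp_all)
  qed (use s1 u in simp_all)
qed

end

text \<open>Initially the input occupies all cells with a fixed address except \<open>0\<close> and \<open>1\<close>. The letters
  in the cells needed as registers are therefore first shifted into cell \<open>0\<close>, below \<open>n\<close>, which needs
  no scratch cell because doubling is an addition.\<close>

definition pack_code :: "nat \<Rightarrow> nat \<Rightarrow> instr list" where
  "pack_code \<sigma> i = replicate \<sigma> (Add 0 0 0) @ [Add 0 0 (i + 2)]"

text \<open>After packing, cells 2 and 3 are free. The leading digit \<open>n\<close> is read off at
  once, since the base address of the arrays must be known before any array is written; cell
  \<open>basec\<close> too held a letter that is packed by now.\<close>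

definition prologue :: "nat \<Rightarrow> instr list" where
  "prologue \<sigma> = concat (map (pack_code \<sigma>) [0..<packed]) @
     [LoadC 3 ((2 ^ \<sigma>) ^ packed), Div 2 0 3, LoadC 3 hdr, Add basec 2 3]"

lemma fold_double:
  assumes "m 0 * 2 ^ j < 2 ^ w"
  shows "fold (eff w) (replicate j (Add 0 0 0)) m = m(0 := m 0 * 2 ^ j)"
  using assms
proof (induction j arbitrary: m)
  case (Suc j)
  have "m 0 * 2 \<le> m 0 * 2 ^ Suc j" by simp
  also note Suc.prems
  finally have "eff w (Add 0 0 0) m = m(0 := m 0 * 2)" by (simp add: mult_2_right)
  then have "fold (eff w) (replicate (Suc j) (Add 0 0 0)) m =
      fold (eff w) (replicate j (Add 0 0 0)) (m(0 := m 0 * 2))"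
    by (simp only: replicate_Suc fold_Cons o_apply)
  also have "\<dots> = (m(0 := m 0 * 2))(0 := (m(0 := m 0 * 2)) 0 * 2 ^ j)"
    using Suc.prems by (intro Suc.IH) (simp add: ac_simps)
  also have "\<dots> = m(0 := m 0 * 2 ^ Suc j)" by (simp add: ac_simps)
  finally show ?case .
qed simp

lemma fold_pack_code:
  assumes "\<And>i. m (i + 2) < 2 ^ \<sigma>" "pack (2 ^ \<sigma>) (\<lambda>i. m (i + 2)) (m 0) j < 2 ^ w"
  shows "fold (eff w) (concat (map (pack_code \<sigma>) [0..<j])) m =
    m(0 := pack (2 ^ \<sigma>) (\<lambda>i. m (i + 2)) (m 0) j)"
  using assms(2)
proof (induction j)
  case (Suc j)
  let ?p = "pack (2 ^ \<sigma>) (\<lambda>i. m (i + 2)) (m 0)"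
  have "?p j \<le> ?p (Suc j)" by (rule pack_mono) simp_all
  then have IH: "fold (eff w) (concat (map (pack_code \<sigma>) [0..<j])) m = m(0 := ?p j)"
    by (intro Suc.IH le_less_trans[OF _ Suc.prems])
  have "(m(0 := ?p j)) 0 * 2 ^ \<sigma> < 2 ^ w" using Suc.prems by simp
  then have "fold (eff w) (replicate \<sigma> (Add 0 0 0)) (m(0 := ?p j)) =
      (m(0 := ?p j))(0 := (m(0 := ?p j)) 0 * 2 ^ \<sigma>)"
    by (rule fold_double)
  then have "fold (eff w) (pack_code \<sigma> j) (m(0 := ?p j)) = m(0 := ?p (Suc j))"
    unfolding pack_code_def fold_append o_apply using Suc.prems by simp
  then have "fold (eff w) (pack_code \<sigma> j) (fold (eff w) (concat (map (pack_code \<sigma>) [0..<j])) m) =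
      m(0 := ?p (Suc j))"
    unfolding IH .
  moreover have "concat (map (pack_code \<sigma>) [0..<Suc j]) =
      concat (map (pack_code \<sigma>) [0..<j]) @ pack_code \<sigma> j" by simp
  ultimately show ?case by (simp only: fold_append o_apply)
qed simp

lemma straight_prologue: "list_all straight (prologue \<sigma>)"
  by (auto simp: prologue_def pack_code_def list_all_iff)

context seed_ram
begin

section \<open>Correctness of the whole program and the time bound\<close>

lemma wp_main:
  fixes u :: "nat list"
  assumes s: "s (V 0) = n" "s (V 1) = k" and u: "length u = n"
      "\<And>i. i < n \<Longrightarrow> s (A 0 i) = u ! i"
    and Q: "\<And>s' T'. s' (V 0) = of_bool (has_seed_of_length u k) \<Longrightarrow>
      T' \<le> T + 30100 * (n + 1) \<Longrightarrow> Q s' T'"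
  shows "wp main_com Q s T"
proof -
  have len: "k \<le> n" if "has_seed_of_length u k"
    using that u by (auto simp: has_seed_of_length_def seed_def factor_def)
  \<comment> \<open>The empty word covers only the empty word.\<close>
  have zero: "has_seed_of_length u 0 \<longleftrightarrow> n = 0"
    using u by (auto simp: has_seed_of_length_def seed_def factor_def covers_def occurs_at_def
        intro!: exI[of _ "[]"])
  show ?thesis
    unfolding main_com_def
  proof (rule wp_Cond)
    assume "ev (Lt (X 0) (X 1)) s \<noteq> 0"
    then have "\<not> has_seed_of_length u k" using len s by auto
    then show "wp (Assign 0 (N 0)) (\<lambda>s' T'. Q s' (T' + 1)) s (T + (esize (Lt (X 0) (X 1)) + 1))"
      by (intro wp_Assign Q) simp_all
  next
    assume "ev (Lt (X 0) (X 1)) s = 0"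
    then have k: "k \<le> n" using s by simp
    show "wp (Cond (X 1) seed_com (Assign 0 (Eq (X 0) (N 0)))) Q s (T + (esize (Lt (X 0) (X 1)) + 1))"
    proof (rule wp_Cond)
      assume "ev (X 1) s \<noteq> 0"
      then have "1 \<le> k" using s by simp
      then show "wp seed_com (\<lambda>s' T'. Q s' (T' + 1)) s
          (T + (esize (Lt (X 0) (X 1)) + 1) + (esize (X 1) + 1))"
        by (intro wp_seed[OF s _ k u] Q) simp_all
    next
      assume "ev (X 1) s = 0"
      then show "wp (Assign 0 (Eq (X 0) (N 0))) Q s
          (T + (esize (Lt (X 0) (X 1)) + 1) + (esize (X 1) + 1))"
        using s zero by (intro wp_Assign Q) simp_all
    qed simp
  qed simp
qed

lemma wp_unpack:
  assumes s: "s (V 0) = pack q inp n packed" and inp: "\<And>i. inp i < q"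
    and small: "pack q inp n packed < 2 ^ w" "q < 2 ^ w"
    and Q: "\<And>s' T'. s' (V 0) = n \<Longrightarrow> s' (V 1) = s (V 1) \<Longrightarrow>
      (\<And>i. i < n \<Longrightarrow> s' (A 0 i) = inp i) \<Longrightarrow> T' \<le> T + 10000 * (n + 1) \<Longrightarrow> Q s' T'"
  shows "wp (unpack_com q) Q s T"
proof -
  let ?pk = "pack q inp n"
  let ?b1 = "Assign 2 (X 2 \<ominus> N 1);; Assign 9 (Bop Over (X 0) (N q));;
        Upd 0 (X 2) (X 0 \<ominus> Bop Times (X 9) (N q));; Assign 0 (X 9)"
  let ?b2 = "Upd 0 (X 2) (In (X 2));; incr 2"
  have q: "0 < q" using inp[of 0] by simp
  have pk39: "packed \<le> 39" by (simp add: packed_def hdr_def)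
  define I where "I = (\<lambda>s' T'. s' (V 2) \<le> packed \<and> s' (V 0) = ?pk (s' (V 2)) \<and>
    (\<forall>i. s' (V 2) \<le> i \<longrightarrow> i < packed \<longrightarrow> s' (A 0 i) = inp i) \<and>
    T' \<le> T + 20 + 100 * (packed - s' (V 2)))"
  define J where "J = (\<lambda>s' T'. packed \<le> s' (V 2) \<and> (\<forall>i < s' (V 2). s' (A 0 i) = inp i) \<and>
    T' \<le> T + 4000 + 100 * s' (V 2) \<and> s' (V 2) \<le> max packed n)"
  have main: "wp (While (Lt (X 2) (X 0)) ?b2) Q s1 T1"
    if s1: "s1 (V 0) = n" "s1 (V 1) = s (V 1)" "J s1 T1" for s1 T1
  proof (rule wp_While[where I = J and \<mu> = "\<lambda>s'. n - s' (V 2)"])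
    show "J s1 T1" by fact
    fix s' T' assume J: "J s' T'" and fr: "\<And>l. \<not> modifies ?b2 l \<Longrightarrow> s' l = s1 l"
    let ?i = "s' (V 2)" and ?T = "T' + (esize (Lt (X 2) (X 0)) + 1)"
    have e: "s' (V 0) = n" "s' (V 1) = s (V 1)" using fr s1 by simp_all
    have i: "packed \<le> ?i" "\<And>i. i < ?i \<Longrightarrow> s' (A 0 i) = inp i" "T' \<le> T + 4000 + 100 * ?i" "?i \<le> max packed n"
      using J by (auto simp: J_def)
    have fin: "Q s' ?T" if c: "\<not> ?i < n"
    proof (rule Q[OF e])
      show "s' (A 0 i) = inp i" if "i < n" for i using i(2) that c by simp
      show "?T \<le> T + 10000 * (n + 1)" using i(3,4) pk39 by simp
    qed
    have step: "wp ?b2 (\<lambda>s'' T''. J s'' (T'' + 1) \<and> n - s'' (V 2) < n - ?i) s' ?T" if c: "?i < n"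
    proof -
      \<comment> \<open>The second loop starts at \<open>packed\<close>, which is the letter in cell
        \<open>hdr\<close>, the first one that no register has overwritten.\<close>
      have "hdr \<le> ?i + 2" "?i + 2 < n + hdr" using i(1) c unfolding packed_def hdr_def by simp_all
      then show ?thesis using c
        by (intro wp_Seq wp_Upd wp_incr) (use i in \<open>auto simp: J_def less_Suc_eq\<close>)
    qed
    show "ok (Lt (X 2) (X 0)) s' \<and> (ev (Lt (X 2) (X 0)) s' = 0 \<longrightarrow> Q s' ?T) \<and>
      (ev (Lt (X 2) (X 0)) s' \<noteq> 0 \<longrightarrow> wp ?b2 (\<lambda>s'' T''. J s'' (T'' + 1) \<and> n - s'' (V 2) < n - ?i) s' ?T)"
      using e(1) fin step by simp
  qed
  show ?thesis
    unfolding unpack_com_def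
  proof (rule wp_Seq, rule wp_Assign, use pk39 in simp, rule wp_Seq,
      rule wp_While[where I = I and \<mu> = "\<lambda>s'. s' (V 2)"])
    let ?s = "s(V 2 := ev (N packed) s)"
    show "I ?s (T + (esize (N packed) + 2))" using s by (simp add: I_def)
    fix s' T' assume I: "I s' T'" and fr: "\<And>l. \<not> modifies ?b1 l \<Longrightarrow> s' l = ?s l"
    let ?i = "s' (V 2)" and ?T = "T' + (esize (X 2) + 1)"
    have e: "s' (V 1) = s (V 1)" using fr by simp
    have i: "?i \<le> packed" "s' (V 0) = ?pk ?i" "T' \<le> T + 20 + 100 * (packed - ?i)"
      "\<And>i. ?i \<le> i \<Longrightarrow> i < packed \<Longrightarrow> s' (A 0 i) = inp i"
      using I by (auto simp: I_def)
    have fin: "wp (Assign 2 (N packed);; While (Lt (X 2) (X 0)) ?b2) Q s' ?T" if c: "?i = 0"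
    proof (rule wp_Seq, rule wp_Assign)
      let ?s1 = "s'(V 2 := ev (N packed) s')"
      show "wp (While (Lt (X 2) (X 0)) ?b2) Q ?s1 (?T + (esize (N packed) + 2))"
        using c i e pk39 by (intro main) (simp_all add: J_def)
    qed (use pk39 in simp)
    have step: "wp ?b1 (\<lambda>s'' T''. I s'' (T'' + 1) \<and> s'' (V 2) < ?i) s' ?T" if c: "0 < ?i"
    proof -
      obtain j where j: "?i = Suc j" using c by (cases ?i) auto
      have jp: "j < packed" using i(1) j by simp
      have v: "s' (V 0) = ?pk j * q + inp j" using i(2) j by simp
      have fj: "fits_idx j" using jp pk39 word_large unfolding fits_idx_def
        by (simp add: narr_def hdr_def)
      have dv: "(?pk j * q + inp j) div q = ?pk j" using inp[of j] q by simp
      have "?pk j * q \<le> ?pk (Suc j)" by simp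
      also have "\<dots> \<le> ?pk packed" using q jp by (intro pack_mono) simp_all
      finally have fit: "fits (?pk j * q)" "fits q" using small by (simp_all add: fits_def)
      have old: "s' (A 0 i) = inp i" if "j < i" "i < packed" for i using i(4)[of i] that j by simp
      have "packed - j = Suc (packed - Suc j)" using jp by simp
      then have I': "I (s'(V 2 := j, V 9 := ?pk j, A 0 j := inp j, V 0 := ?pk j)) (T' + 80)"
        using i(3) old jp j unfolding I_def by auto
      have mono: "I s1 T1 \<Longrightarrow> T2 \<le> T1 \<Longrightarrow> I s1 T2" for s1 T1 T2 by (auto simp: I_def)
      show ?thesis
        by (intro wp_Seq wp_Assign wp_Upd)
          (use j jp pk39 v dv fit fj I' in \<open>auto elim!: mono simp del: pack.simps\<close>)
    qed
    show "ok (X 2) s' \<and>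
      (ev (X 2) s' = 0 \<longrightarrow> wp (Assign 2 (N packed);; While (Lt (X 2) (X 0)) ?b2) Q s' ?T) \<and>
      (ev (X 2) s' \<noteq> 0 \<longrightarrow> wp ?b1 (\<lambda>s'' T''. I s'' (T'' + 1) \<and> s'' (V 2) < ?i) s' ?T)"
      using fin step by simp
  qed
qed

end

theorem theorem4:
  shows "\<forall>\<sigma>::nat. \<exists>(P::instr list) (c::nat) (d::nat).
    \<forall>(w::nat) (u::nat list) (k::nat).
      set u \<subseteq> {..<\<sigma>} \<and> \<sigma> \<le> 2 ^ w \<and> k < 2 ^ w \<and> (length u + 2) ^ d \<le> 2 ^ w \<longrightarrow>
      (\<exists>t \<le> c * (length u + 1).
         halted P (run w P t u k) \<and>
         snd (run w P t u k) 0 = (if has_seed_of_length u k then 1 else 0))"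
proof
  fix \<sigma> :: nat
  \<comment> \<open>A power of two, so that a shift by one digit is \<sigma> doublings, and larger
    than every letter.\<close>
  define q :: nat where "q = 2 ^ \<sigma>"
  define body where "body = unpack_com q;; main_com"
  define pro where "pro = prologue \<sigma>"
  define P where "P = pro @ ccom (length pro) body"
  \<comment> \<open>Besides the prologue, at most 10000 steps per unit of \<open>n + 1\<close> go to
    unpacking and 30100 to the decision; the rest is slack.\<close>
  define c where "c = length pro + 41000"
  \<comment> \<open>As \<open>n + 2 >= 2\<close>, the first \<sigma> times \<open>packed\<close>
    factors dominate \<open>q ^ packed\<close> for the packed letters, 19 more dominate the constant
    \<open>2 ^ 19\<close>, and the last one is \<open>n + 2\<close> itself.\<close>
  define d where "d = \<sigma> * packed + 20"
  have "\<exists>t \<le> c * (length u + 1). halted P (run w P t u k) \<and>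
         snd (run w P t u k) 0 = (if has_seed_of_length u k then 1 else 0)"
    if u: "set u \<subseteq> {..<\<sigma>}" and k: "k < 2 ^ w" and w: "(length u + 2) ^ d \<le> 2 ^ w" for w u k
  proof -
    define n where "n = length u"
    define m where "m = init_mem u k"
    define x where "x = (\<lambda>i. m (i + 2))"
    have m: "m 0 = n" "m 1 = k" by (simp_all add: m_def init_mem_def n_def)
    have xu: "x i = u ! i" if "i < n" for i using that by (simp add: x_def m_def init_mem_def n_def)
    have x: "x i < q" for i
    proof (cases "i < n")
      case True
      then have "u ! i < \<sigma>" using u nth_mem unfolding n_def by blast
      also have "\<dots> < q" unfolding q_def by (rule less_exp)
      finally show ?thesis using xu True by simp
    next
      case False
      then show ?thesis by (simp add: x_def m_def init_mem_def n_def q_def)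
    qed
    have q1: "1 \<le> q" by (simp add: q_def)
    have qp: "q ^ packed = 2 ^ (\<sigma> * packed)" by (simp add: q_def power_mult)
    have "q ^ packed * (2 ^ 19 * (n + 2)) \<le> (n + 2) ^ (\<sigma> * packed) * ((n + 2) ^ 19 * (n + 2))"
      unfolding qp by (intro mult_le_mono power_mono) simp_all
    also have "\<dots> = (n + 2) ^ d" unfolding d_def
      by (simp only: power_add[symmetric] power_Suc2[symmetric]) simp
    also have "\<dots> \<le> 2 ^ w" using w by (simp add: n_def)
    finally have big: "q ^ packed * (2 ^ 19 * (n + 2)) \<le> 2 ^ w" .
    have "1 \<le> q ^ packed" using q1 by (rule one_le_power)
    then have "2 ^ 19 * (n + 2) \<le> q ^ packed * (2 ^ 19 * (n + 2))" by simp
    with big have large: "2 ^ 19 * (n + 2) \<le> (2::nat) ^ w" by (rule order_trans[rotated])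
    have "q ^ packed * (n + 1) < q ^ packed * (2 ^ 19 * (n + 2))"
      using q1 by (intro mult_strict_left_mono) simp_all
    with big have qn: "(n + 1) * q ^ packed < 2 ^ w" by (simp add: mult.commute)
    have "q ^ packed * 1 \<le> q ^ packed * (n + 1)" by (rule mult_le_mono2) simp
    with qn have qpw: "q ^ packed < 2 ^ w" by (simp add: mult.commute)
    have "q ^ 1 \<le> q ^ packed" using q1 by (intro power_increasing) (simp_all add: packed_def hdr_def)
    with qpw have qw: "q < 2 ^ w" by simp
    have pw: "pack q x n packed < 2 ^ w"
      using pack_less[of x q n packed] x qn by simp
    interpret seed_ram w x n
      by unfold_locales (use large in \<open>simp_all add: hdr_def\<close>)
    define m' where "m' = fold (eff w) pro m"
    have m': "m' = m(0 := pack q x n packed, 2 := n, 3 := hdr, basec := n + hdr)"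
    proof -
      have "fold (eff w) (concat (map (pack_code \<sigma>) [0..<packed])) m = m(0 := pack q x n packed)"
        using fold_pack_code[of m \<sigma> packed w] x pw m by (simp add: x_def q_def)
      moreover have "pack q x n packed div q ^ packed = n" using pack_div x by blast
      ultimately show ?thesis
        unfolding m'_def pro_def prologue_def q_def[symmetric]
        using qpw hdr_less b_less by (auto simp: fun_eq_iff basec_def)
    qed
    define s where "s l = (case l of V i \<Rightarrow> m' i | A j i \<Rightarrow> m' (n + hdr + narr * i + j))" for l
    have rep: "rep m' s"
      unfolding rep_def by (auto simp: s_def m' x_def basec_def hdr_def)
    have "wp body (\<lambda>s' T'. s' (V 0) = of_bool (has_seed_of_length u k) \<and> T' \<le> 40200 * (n + 1)) s 0"
      unfolding body_def
    proof (rule wp_Seq, rule wp_unpack[OF _ x pw qw])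
      show "s (V 0) = pack q x n packed" by (simp add: s_def m' basec_def)
      fix s1 T1
      assume s1: "s1 (V 0) = n" "s1 (V 1) = s (V 1)" "\<And>i. i < n \<Longrightarrow> s1 (A 0 i) = x i"
        and T1: "T1 \<le> 0 + 10000 * (n + 1)"
      have "s1 (V 1) = k" using s1(2) m by (simp add: s_def m' basec_def)
      then show "wp main_com (\<lambda>s' T'. s' (V 0) = of_bool (has_seed_of_length u k) \<and>
          T' \<le> 40200 * (n + 1)) s1 T1"
        using s1 xu T1 by (intro wp_main[of s1 k u]) (simp_all add: n_def)
    qed
    then obtain s' t where t: "big body s t s'" "s' (V 0) = of_bool (has_seed_of_length u k)"
      "t \<le> 40200 * (n + 1)"
      unfolding wp_def by auto
    have "wf_com body"
      by (simp add: body_def unpack_com_def main_com_def seed_com_def fill_def lce_com_def zcom_def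
          zcopy_def zextend_def max_com_def period_com_def mark_com_def mark_body_def answer_com_def
          incr_def Lt_def And_def Eq_def nvars_def basec_def narr_def)
    from ccom_correct[OF t(1) this rep, of pro "[]"]
    obtain m'' where m'': "(step w P ^^ t) (length pro, m') = (length P, m'')" "rep m'' s'"
      by (auto simp: P_def length_ccom)
    have "(step w P ^^ length pro) (0, m) = (length pro, m')"
      using steps_straight[OF straight_prologue[of \<sigma>], of w "[]" "ccom (length pro) body" m]
      by (simp add: P_def pro_def m'_def)
    from funpow_trans[OF this m''(1)]
    have run: "run w P (length pro + t) u k = (length P, m'')" by (simp add: run_def m_def)
    have "m'' 0 = s' (V 0)" using m''(2) by (simp add: rep_def nvars_def)
    then show ?thesis
      using run t(2,3) by (intro exI[of _ "length pro + t"]) (auto simp: halted_def c_def n_def algebra_simps)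
  qed
  then show "\<exists>(P::instr list) (c::nat) (d::nat).
    \<forall>(w::nat) (u::nat list) (k::nat).
      set u \<subseteq> {..<\<sigma>} \<and> \<sigma> \<le> 2 ^ w \<and> k < 2 ^ w \<and> (length u + 2) ^ d \<le> 2 ^ w \<longrightarrow>
      (\<exists>t \<le> c * (length u + 1).
         halted P (run w P t u k) \<and>
         snd (run w P t u k) 0 = (if has_seed_of_length u k then 1 else 0))"
    by blast
qed

end
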